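(* Suppose $\widetilde{\mathcal S}$ is an embedded Riemannian submanifold of $(\mathcal S,g)$, both equipped with their respective Riemannian (Levi-Civita) connections. Let $f\in C^\infty(\mathcal S)$ be any smooth function. Then $h:=f|_{\widetilde{\mathcal S}}$ is smooth on $\widetilde{\mathcal S}$ and $$\mathrm{grad}\,h=\pi^\top\big(\mathrm{grad}\,f|_{\widetilde{\mathcal S}}\big).$$ Furthermore, under the identification $T\widetilde{\mathcal S}\subset T\mathcal S$, for any $V\in\mathfrak X(\widetilde{\mathcal S})$, $$\mathrm{Hess}\,h[V]=\pi^\top\big(\mathrm{Hess}\,f[V]\big|_{\widetilde{\mathcal S}}\big)+\mathbb W_{\pi^\perp(\mathrm{grad}\,f|_{\widetilde{\mathcal S}})}[V],$$ where $V$ is arbitrarily extended to a vector field on a neighborhood of $\widetilde{\mathcal S}$ in $\mathcal S$.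
   Context: $M(p\times q,\mathbb R)$ is the space of real $p\times q$ matrices and $\rho$ the spectral radius. Fix a stabilizable pair $(A,B)$, $A\in M(n\times n,\mathbb R)$, $B\in M(n\times m,\mathbb R)$. Let $\mathcal S=\{K\in M(m\times n,\mathbb R):\rho(A+BK)<1\}$ (an open subset of $M(m\times n,\mathbb R)$), $A_{\mathrm{cl}}=A+BK$, and identify $T_K\mathcal S\cong M(m\times n,\mathbb R)$. For $\rho(M)<1$, $\mathbb L(M,Z)$ is the unique solution $X$ of $X=MXM^\top+Z$. Fix $\Sigma_1,\Sigma_2\succeq0$, let $\Sigma_K=\Sigma_1+K^\top\Sigma_2K$, and assume $(A_{\mathrm{cl}},\Sigma_K^{1/2})$ is controllable for all $K\in\mathcal S$, so that $g_K(V,W)=\langle V,W\rangle|_K=\mathrm{tr}[V^\top W\,\mathbb L(A_{\mathrm{cl}},\Sigma_K)]$ is a Riemannian metric on $\mathcal S$, with Levi-Civita connection $\nabla$. $\widetilde{\mathcal S}$ carries the metric $\widetilde g=\iota^*g$ pulled back by inclusion, with Levi-Civita connection $\widetilde\nabla$. $\mathfrak X(\cdot)$ denotes smooth vector fields. $\mathrm{grad}\,f$ is the gradient with respect to $g$, $\mathrm{grad}\,h$ that with respect to $\widetilde g$; $\mathrm{Hess}\,f[U]=\nabla_U\,\mathrm{grad}\,f$ for $U\in\mathfrak X(\mathcal S)$ and $\mathrm{Hess}\,h[V]=\widetilde\nabla_V\,\mathrm{grad}\,h$ for $V\in\mathfrak X(\widetilde{\mathcal S})$. $\pi^\top:T\mathcal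 S|_{\widetilde{\mathcal S}}\to T\widetilde{\mathcal S}$ and $\pi^\perp:T\mathcal S|_{\widetilde{\mathcal S}}\to N\widetilde{\mathcal S}$ are the $g$-orthogonal tangential and normal projections ($N\widetilde{\mathcal S}$ the normal bundle). For a normal vector field $N$ (smooth section of $N\widetilde{\mathcal S}$), the Weingarten map $\mathbb W_N:\mathfrak X(\widetilde{\mathcal S})\to\mathfrak X(\widetilde{\mathcal S})$ is the self-adjoint map characterized by $\langle\mathbb W_N[V],W\rangle=\langle N,\pi^\perp(\nabla_VW)\rangle$ for all $V,W\in\mathfrak X(\widetilde{\mathcal S})$ (extended arbitrarily to a neighborhood in $\mathcal S$ to form $\nabla_VW$). *)

theory Defs
  imports "HOL-Analysis.Analysis"
begin

definition spectral_radius :: "real^'n^'n \<Rightarrow> real" where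
  "spectral_radius M =
     Max {cmod z | z. \<exists>v::complex^'n. v \<noteq> 0 \<and> (\<chi> i j. complex_of_real (M $ i $ j)) *v v = z *s v}"

definition stabilizing :: "real^'n^'n \<Rightarrow> real^'m^'n \<Rightarrow> (real^'n^'m) set" where
  "stabilizing A B = {K. spectral_radius (A + B ** K) < 1}"

definition stabilizable :: "real^'n^'n \<Rightarrow> real^'m^'n \<Rightarrow> bool" where
  "stabilizable A B \<longleftrightarrow> (\<exists>K. spectral_radius (A + B ** K) < 1)"

text \<open>Kalman's rank condition: the columns of \<open>M\<^sup>k C\<close>, \<open>k < n\<close>, have rank \<open>n\<close>.\<close>

definition controllable :: "real^'n^'n \<Rightarrow> real^'p^'n \<Rightarrow> bool" where
  "controllable M C \<longleftrightarrow> dim (\<Union>k<CARD('n). columns (((\<lambda>X. M ** X) ^^ k) C)) = CARD('n)"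

definition psd :: "real^'n^'n \<Rightarrow> bool" where
  "psd M \<longleftrightarrow> transpose M = M \<and> (\<forall>x. 0 \<le> x \<bullet> (M *v x))"

definition psd_sqrt :: "real^'n^'n \<Rightarrow> real^'n^'n" where
  "psd_sqrt M = (THE R. psd R \<and> R ** R = M)"

definition lyapunov :: "real^'n^'n \<Rightarrow> real^'n^'n \<Rightarrow> real^'n^'n" where
  "lyapunov M Z = (THE X. X = M ** X ** transpose M + Z)"

definition Sigma_gain :: "real^'n^'n \<Rightarrow> real^'m^'m \<Rightarrow> real^'n^'m \<Rightarrow> real^'n^'n" where
  "Sigma_gain Sig1 Sig2 K = Sig1 + transpose K ** Sig2 ** K"

definition gain_metric ::
  "real^'n^'n \<Rightarrow> real^'m^'n \<Rightarrow> real^'n^'n \<Rightarrow> real^'m^'m \<Rightarrow>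
     real^'n^'m \<Rightarrow> real^'n^'m \<Rightarrow> real^'n^'m \<Rightarrow> real" where
  "gain_metric A B Sig1 Sig2 K V W =
     trace (transpose V ** W ** lyapunov (A + B ** K) (Sigma_gain Sig1 Sig2 K))"

text \<open>The following two notions are meant for open \<open>U\<close>.\<close>

primrec C_k_on :: "nat \<Rightarrow> 'a::euclidean_space set \<Rightarrow> ('a \<Rightarrow> 'b::real_normed_vector) \<Rightarrow> bool" where
  "C_k_on 0 U f \<longleftrightarrow> continuous_on U f"
| "C_k_on (Suc k) U f \<longleftrightarrow>
     (\<forall>x\<in>U. f differentiable at x) \<and> (\<forall>v. C_k_on k U (\<lambda>x. frechet_derivative f (at x) v))"

definition smooth_on :: "'a::euclidean_space set \<Rightarrow> ('a \<Rightarrow> 'b::real_normed_vector) \<Rightarrow> bool" where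
  "smooth_on U f \<longleftrightarrow> (\<forall>k. C_k_on k U f)"

text \<open>Smoothness of a map on a subset \<open>M\<close> (an embedded submanifold, in particular an open set):
  locally around every point of \<open>M\<close> it is the restriction of a smooth map on an open set of the
  ambient space. Values off \<open>M\<close> are irrelevant.\<close>

definition smooth_map :: "'a::euclidean_space set \<Rightarrow> ('a \<Rightarrow> 'b::real_normed_vector) \<Rightarrow> bool" where
  "smooth_map M f \<longleftrightarrow>
     (\<forall>p\<in>M. \<exists>U F. open U \<and> p \<in> U \<and> smooth_on U F \<and> (\<forall>x\<in>U \<inter> M. F x = f x))"

text \<open>Embedded submanifolds (of constant dimension \<open>k\<close>) of an open set \<open>S\<close>: subsets satisfying the
  local slice condition.\<close>

definition embedded_submanifold :: "'a::euclidean_space set \<Rightarrow> 'a set \<Rightarrow> bool" where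
  "embedded_submanifold S M \<longleftrightarrow> M \<subseteq> S \<and>
     (\<exists>k. \<forall>p\<in>M. \<exists>U (\<phi> :: 'a \<Rightarrow> 'a) \<psi> (L :: 'a set).
        open U \<and> p \<in> U \<and> U \<subseteq> S \<and> smooth_on U \<phi> \<and>
        open (\<phi> ` U) \<and> smooth_on (\<phi> ` U) \<psi> \<and> (\<forall>x\<in>U. \<psi> (\<phi> x) = x) \<and>
        subspace L \<and> dim L = k \<and> \<phi> ` (U \<inter> M) = \<phi> ` U \<inter> L)"

text \<open>Tangent vectors are velocities of smooth curves in \<open>M\<close>; they are vectors of the ambient space,
  so the differential of an inclusion of submanifolds is the inclusion of tangent spaces.\<close>

definition curve_at :: "'a::euclidean_space set \<Rightarrow> 'a \<Rightarrow> 'a \<Rightarrow> (real \<Rightarrow> 'a) \<Rightarrow> bool" where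
  "curve_at M p v c \<longleftrightarrow>
     (\<exists>e>0. smooth_on {-e<..<e} c \<and> c ` {-e<..<e} \<subseteq> M) \<and>
     c 0 = p \<and> (c has_vector_derivative v) (at 0)"

definition tangent_space :: "'a::euclidean_space set \<Rightarrow> 'a \<Rightarrow> 'a set" where
  "tangent_space M p = {v. \<exists>c. curve_at M p v c}"

text \<open>The derivative \<open>v u\<close> of a function \<open>u\<close> on \<open>M\<close> along a tangent vector \<open>v\<close> at \<open>p\<close>.\<close>

definition tderiv :: "'a::euclidean_space set \<Rightarrow> ('a \<Rightarrow> real) \<Rightarrow> 'a \<Rightarrow> 'a \<Rightarrow> real" where
  "tderiv M u p v =
     (THE d. \<forall>c. curve_at M p v c \<longrightarrow> ((\<lambda>t. u (c t)) has_real_derivative d) (at 0))"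

definition vector_fields :: "'a::euclidean_space set \<Rightarrow> ('a \<Rightarrow> 'a) set" where
  "vector_fields M = {V. smooth_map M V \<and> (\<forall>p\<in>M. V p \<in> tangent_space M p)}"

type_synonym 'a conn = "('a \<Rightarrow> 'a) \<Rightarrow> ('a \<Rightarrow> 'a) \<Rightarrow> 'a \<Rightarrow> 'a"
type_synonym 'a metric_tensor = "'a \<Rightarrow> 'a \<Rightarrow> 'a \<Rightarrow> real"

text \<open>Vector fields on \<open>M\<close> are represented by functions on the whole type, hence the second clause,
  which says that a connection depends only on their values on \<open>M\<close>.\<close>

definition affine_connection :: "'a::euclidean_space set \<Rightarrow> 'a conn \<Rightarrow> bool" where
  "affine_connection M nab \<longleftrightarrow>
     (\<forall>V\<in>vector_fields M. \<forall>W\<in>vector_fields M. nab V W \<in> vector_fields M) \<and>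
     (\<forall>V\<in>vector_fields M. \<forall>V'\<in>vector_fields M. \<forall>W\<in>vector_fields M. \<forall>W'\<in>vector_fields M.
        (\<forall>q\<in>M. V q = V' q \<and> W q = W' q) \<longrightarrow> (\<forall>p\<in>M. nab V W p = nab V' W' p)) \<and>
     (\<forall>V1\<in>vector_fields M. \<forall>V2\<in>vector_fields M. \<forall>W\<in>vector_fields M.
        \<forall>a b :: 'a \<Rightarrow> real. smooth_map M a \<and> smooth_map M b \<longrightarrow>
        (\<forall>p\<in>M. nab (\<lambda>q. a q *\<^sub>R V1 q + b q *\<^sub>R V2 q) W p
               = a p *\<^sub>R nab V1 W p + b p *\<^sub>R nab V2 W p)) \<and>
     (\<forall>V\<in>vector_fields M. \<forall>W1\<in>vector_fields M. \<forall>W2\<in>vector_fields M. \<forall>a b :: real.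
        (\<forall>p\<in>M. nab V (\<lambda>q. a *\<^sub>R W1 q + b *\<^sub>R W2 q) p
               = a *\<^sub>R nab V W1 p + b *\<^sub>R nab V W2 p)) \<and>
     (\<forall>V\<in>vector_fields M. \<forall>W\<in>vector_fields M. \<forall>a :: 'a \<Rightarrow> real. smooth_map M a \<longrightarrow>
        (\<forall>p\<in>M. nab V (\<lambda>q. a q *\<^sub>R W q) p
               = a p *\<^sub>R nab V W p + tderiv M a p (V p) *\<^sub>R W p))"

text \<open>Symmetry is stated by letting both sides of \<open>\<nabla>\<^sub>V W - \<nabla>\<^sub>W V = [V, W]\<close> act on functions.\<close>

definition torsion_free :: "'a::euclidean_space set \<Rightarrow> 'a conn \<Rightarrow> bool" where
  "torsion_free M nab \<longleftrightarrow>
     (\<forall>V\<in>vector_fields M. \<forall>W\<in>vector_fields M. \<forall>u :: 'a \<Rightarrow> real. smooth_map M u \<longrightarrow>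
        (\<forall>p\<in>M. tderiv M u p (nab V W p - nab W V p)
               = tderiv M (\<lambda>q. tderiv M u q (W q)) p (V p)
                 - tderiv M (\<lambda>q. tderiv M u q (V q)) p (W p)))"

definition metric_compatible ::
  "'a::euclidean_space set \<Rightarrow> 'a metric_tensor \<Rightarrow> 'a conn \<Rightarrow> bool" where
  "metric_compatible M g nab \<longleftrightarrow>
     (\<forall>V\<in>vector_fields M. \<forall>W\<in>vector_fields M. \<forall>Z\<in>vector_fields M. \<forall>p\<in>M.
        tderiv M (\<lambda>q. g q (W q) (Z q)) p (V p)
          = g p (nab V W p) (Z p) + g p (W p) (nab V Z p))"

text \<open>Tangent spaces of a submanifold are subspaces of the ambient space, so the metric pulled back
  to a submanifold by inclusion is represented by \<open>g\<close> itself.\<close>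

definition levi_civita ::
  "'a::euclidean_space set \<Rightarrow> 'a metric_tensor \<Rightarrow> 'a conn \<Rightarrow> bool" where
  "levi_civita M g nab \<longleftrightarrow>
     affine_connection M nab \<and> torsion_free M nab \<and> metric_compatible M g nab"

text \<open>The usual extension of a connection on \<open>M\<close> to vector fields defined only near \<open>p\<close>: replace them
  by global vector fields on \<open>M\<close> with the same germs at \<open>p\<close>.\<close>

definition local_connection :: "'a::euclidean_space set \<Rightarrow> 'a conn \<Rightarrow> 'a conn" where
  "local_connection M nab V W p =
     (THE u. \<exists>V'\<in>vector_fields M. \<exists>W'\<in>vector_fields M. \<exists>T.
        open T \<and> p \<in> T \<and> (\<forall>q\<in>T \<inter> M. V' q = V q \<and> W' q = W q) \<and> u = nab V' W' p)"

definition grad ::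
  "'a::euclidean_space set \<Rightarrow> 'a metric_tensor \<Rightarrow> ('a \<Rightarrow> real) \<Rightarrow> 'a \<Rightarrow> 'a" where
  "grad M g u p =
     (THE v. v \<in> tangent_space M p \<and> (\<forall>w\<in>tangent_space M p. g p v w = tderiv M u p w))"

definition Hess ::
  "'a::euclidean_space set \<Rightarrow> 'a metric_tensor \<Rightarrow> 'a conn \<Rightarrow> ('a \<Rightarrow> real) \<Rightarrow> ('a \<Rightarrow> 'a) \<Rightarrow> 'a \<Rightarrow> 'a"
  where "Hess M g nab u V = nab V (grad M g u)"

definition normal_space ::
  "'a::euclidean_space set \<Rightarrow> 'a metric_tensor \<Rightarrow> 'a set \<Rightarrow> 'a \<Rightarrow> 'a set" where
  "normal_space S g M p = {v \<in> tangent_space S p. \<forall>w\<in>tangent_space M p. g p v w = 0}"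

definition orth_proj ::
  "'a::euclidean_space metric_tensor \<Rightarrow> 'a \<Rightarrow> 'a set \<Rightarrow> 'a \<Rightarrow> 'a" where
  "orth_proj g p E v = (THE u. u \<in> E \<and> (\<forall>w\<in>E. g p (v - u) w = 0))"

definition tan_proj ::
  "'a::euclidean_space metric_tensor \<Rightarrow> 'a set \<Rightarrow> 'a \<Rightarrow> 'a \<Rightarrow> 'a" where
  "tan_proj g M p = orth_proj g p (tangent_space M p)"

definition nor_proj ::
  "'a::euclidean_space set \<Rightarrow> 'a metric_tensor \<Rightarrow> 'a set \<Rightarrow> 'a \<Rightarrow> 'a \<Rightarrow> 'a" where
  "nor_proj S g M p = orth_proj g p (normal_space S g M p)"

definition extends_to ::
  "'a::euclidean_space set \<Rightarrow> 'a set \<Rightarrow> ('a \<Rightarrow> 'a) \<Rightarrow> 'a set \<Rightarrow> ('a \<Rightarrow> 'a) \<Rightarrow> bool" where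
  "extends_to S M V U V' \<longleftrightarrow>
     open U \<and> M \<subseteq> U \<and> U \<subseteq> S \<and> V' \<in> vector_fields U \<and> (\<forall>p\<in>M. V' p = V p)"

text \<open>\<open>\<W>\<^sub>N[V]\<close> at \<open>p\<close>, for a normal field \<open>N\<close>: the tangent vector characterized by
  \<open>\<langle>\<W>\<^sub>N[V], W\<rangle> = \<langle>N, \<pi>\<^sup>\<bottom>(\<nabla>\<^sub>V W)\<rangle>\<close> for all \<open>W\<close> and all extensions of \<open>V\<close> and \<open>W\<close>.
  Self-adjointness is a consequence and is not built in.\<close>

definition weingarten ::
  "'a::euclidean_space set \<Rightarrow> 'a metric_tensor \<Rightarrow> 'a conn \<Rightarrow> 'a set \<Rightarrow>
     ('a \<Rightarrow> 'a) \<Rightarrow> ('a \<Rightarrow> 'a) \<Rightarrow> 'a \<Rightarrow> 'a" where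
  "weingarten S g nab M N V p =
     (THE u. u \<in> tangent_space M p \<and>
        (\<forall>W\<in>vector_fields M. \<forall>U V' W'. extends_to S M V U V' \<and> extends_to S M W U W' \<longrightarrow>
           g p u (W p) = g p (N p) (nor_proj S g M p (local_connection S nab V' W' p))))"

end

theory Submission
  imports Defs "HOL-Computational_Algebra.Fundamental_Theorem_Algebra"
begin

text \<open>The statement holds for any smooth metric \<open>g\<close> on an open set \<open>S\<close> of a Euclidean space.
  Because vectors of \<open>M\<close> are ambient vectors, the brackets on \<open>M\<close> and on \<open>S\<close> are both
  given by flat derivatives, so the Koszul formulas of the two connections coincide on \<open>M\<close>; this is
  the Gauss formula \<open>\<pi>\<^sup>\<top>(\<nabla>\<^sub>V W) = \<nabla>'\<^sub>V W\<close>. Splitting \<open>grad f = grad h + N\<close> along \<open>M\<close> and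
  differentiating \<open>g(N, W) = 0\<close> identifies \<open>- \<pi>\<^sup>\<top>(\<nabla>\<^sub>V N)\<close> with \<open>\<W>\<^sub>N[V]\<close>.
  For the gain metric one needs that the stabilizing set is open and that the Lyapunov solution is
  smooth in \<open>K\<close> and positive definite.\<close>

subsection \<open>Calculus of smooth maps\<close>

text \<open>The notions are definite descriptions, and connections act on vector fields over all of
  \<open>S\<close> or \<open>M\<close>. So each description has to be shown proper, and local data
  has to be globalised: a bump function turns a germ into a global field that stays tangent to
  \<open>M\<close>. Locality of a Levi-Civita connection is read off from the Koszul expression,
  which only sees germs at the point. Gradients must be smooth, not merely exist at each point.
  Gram-Schmidt along a local frame yields representers that vary smoothly, and the same lemma solves
  linear systems with smooth coefficients, among them the Lyapunov equation. On the matrix side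
  \<open>spectral_radius\<close> speaks of complex eigenvalues, while openness and the Lyapunov
  arguments need powers. An annihilating polynomial, found from linear dependence of the powers,
  links the two: the spectral radius is below one iff the powers tend to zero iff some power has
  absolute entry sum below one. Controllability is phrased with \<open>psd_sqrt\<close>, so
  existence and uniqueness of the square root come before positivity of the metric.\<close>

lemma has_derivative_cong_open:
  assumes "open U" "x \<in> U" "\<And>y. y \<in> U \<Longrightarrow> f y = g y"
  shows "(f has_derivative D) (at x) \<longleftrightarrow> (g has_derivative D) (at x)"
  using assms by (metis has_derivative_transform_within_open)

lemma frechet_derivative_cong_open:
  assumes "open U" "x \<in> U" "\<And>y. y \<in> U \<Longrightarrow> f y = g y"
  shows "frechet_derivative f (at x) = frechet_derivative g (at x)"
  unfolding frechet_derivative_def using has_derivative_cong_open[OF assms] by simp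

lemma differentiable_cong_open:
  assumes "open U" "x \<in> U" "\<And>y. y \<in> U \<Longrightarrow> f y = g y"
  shows "f differentiable at x \<longleftrightarrow> g differentiable at x"
  unfolding differentiable_def using has_derivative_cong_open[OF assms] by simp

lemma C_k_on_cong:
  assumes "open U" "\<And>x. x \<in> U \<Longrightarrow> f x = g x" "C_k_on k U f"
  shows "C_k_on k U g"
  using assms(2,3)
proof (induction k arbitrary: f g)
  case 0
  then show ?case by (simp cong: continuous_on_cong)
next
  case (Suc k)
  have "frechet_derivative f (at x) = frechet_derivative g (at x)" if "x \<in> U" for x
    by (rule frechet_derivative_cong_open[OF assms(1) that Suc.prems(1)])
  then have "C_k_on k U (\<lambda>x. frechet_derivative g (at x) v)" for v
    using Suc.IH[of "\<lambda>x. frechet_derivative f (at x) v" "\<lambda>x. frechet_derivative g (at x) v"]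
      Suc.prems(2) by simp
  moreover have "f differentiable at x \<longleftrightarrow> g differentiable at x" if "x \<in> U" for x
    by (rule differentiable_cong_open[OF assms(1) that Suc.prems(1)])
  ultimately show ?case using Suc.prems(2) by simp
qed

lemma C_k_on_Suc_imp: "C_k_on (Suc k) U f \<Longrightarrow> C_k_on k U f"
proof (induction k arbitrary: f)
  case 0
  then show ?case
    by (simp add: differentiable_imp_continuous_within continuous_at_imp_continuous_on)
next
  case (Suc k)
  have "C_k_on k U (\<lambda>x. frechet_derivative f (at x) v)" for v
    by (rule Suc.IH) (use Suc.prems in simp)
  then show ?case using Suc.prems by simp
qed

text \<open>\<open>frechet_derivative\<close> is a choice term; uniqueness of derivatives lets an
  explicit formula \<open>D\<close> take its place. The inductions on \<open>k\<close> in the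
  closure rules below run through this rule.\<close>

lemma C_k_on_SucI:
  assumes "open U" "\<And>x. x \<in> U \<Longrightarrow> (f has_derivative D x) (at x)" "\<And>v. C_k_on k U (\<lambda>x. D x v)"
  shows "C_k_on (Suc k) U f"
proof -
  have "C_k_on k U (\<lambda>x. frechet_derivative f (at x) v)" for v
    by (rule C_k_on_cong[OF assms(1) _ assms(3)]) (simp add: frechet_derivative_at[OF assms(2)])
  moreover have "f differentiable at x" if "x \<in> U" for x
    using assms(2)[OF that] unfolding differentiable_def by blast
  ultimately show ?thesis by simp
qed

lemma C_k_on_subset: "C_k_on k U f \<Longrightarrow> V \<subseteq> U \<Longrightarrow> C_k_on k V f"
proof (induction k arbitrary: f)
  case 0
  then show ?case using continuous_on_subset by simp
qed (simp add: subset_iff)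

lemma C_k_on_local:
  assumes "\<And>x. x \<in> U \<Longrightarrow> \<exists>T. open T \<and> x \<in> T \<and> C_k_on k T f"
  shows "C_k_on k U f"
  using assms
proof (induction k arbitrary: f)
  case 0
  have "isCont f x" if "x \<in> U" for x
    using 0[OF that] by (auto simp: continuous_on_eq_continuous_at)
  then show ?case by (auto intro: continuous_at_imp_continuous_on)
next
  case (Suc k)
  have "f differentiable at x" if "x \<in> U" for x
    using Suc.prems[OF that] by auto
  moreover have "C_k_on k U (\<lambda>x. frechet_derivative f (at x) v)" for v
  proof (rule Suc.IH)
    fix x assume "x \<in> U"
    then obtain T where "open T" "x \<in> T" "C_k_on (Suc k) T f" using Suc.prems by blast
    then show "\<exists>T. open T \<and> x \<in> T \<and> C_k_on k T (\<lambda>x. frechet_derivative f (at x) v)"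
      by (intro exI[of _ T]) simp
  qed
  ultimately show ?case by simp
qed

lemma C_k_on_has_derivative:
  assumes "C_k_on (Suc k) U f" "x \<in> U"
  shows "(f has_derivative frechet_derivative f (at x)) (at x)"
  using assms by (simp add: frechet_derivative_works[symmetric])

lemma C_k_on_const: "open U \<Longrightarrow> C_k_on k U (\<lambda>x. c)"
proof (induction k arbitrary: c)
  case (Suc k)
  show ?case by (rule C_k_on_SucI[OF Suc.prems, where D = "\<lambda>x v. 0"]) (use Suc in auto)
qed simp

lemma C_k_on_add:
  "open U \<Longrightarrow> C_k_on k U f \<Longrightarrow> C_k_on k U g \<Longrightarrow> C_k_on k U (\<lambda>x. f x + g x)"
proof (induction k arbitrary: f g)
  case 0
  then show ?case by (simp add: continuous_on_add)
next
  case (Suc k)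
  show ?case
    by (rule C_k_on_SucI[OF Suc.prems(1) has_derivative_add[OF
            C_k_on_has_derivative[OF Suc.prems(2)] C_k_on_has_derivative[OF Suc.prems(3)]]])
      (use Suc in auto)
qed

lemma C_k_on_bounded_linear:
  assumes "bounded_linear h"
  shows "open U \<Longrightarrow> C_k_on k U f \<Longrightarrow> C_k_on k U (\<lambda>x. h (f x))"
proof (induction k arbitrary: f)
  case 0
  then show ?case using assms by (auto intro: bounded_linear.continuous_on)
next
  case (Suc k)
  show ?case
    by (rule C_k_on_SucI[OF Suc.prems(1) bounded_linear.has_derivative[OF assms
            C_k_on_has_derivative[OF Suc.prems(2)]]])
      (use Suc in auto)
qed

lemma C_k_on_bounded_bilinear:
  assumes "bounded_bilinear h"
  shows "open U \<Longrightarrow> C_k_on k U f \<Longrightarrow> C_k_on k U g \<Longrightarrow> C_k_on k U (\<lambda>x. h (f x) (g x))"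
proof (induction k arbitrary: f g)
  case 0
  then show ?case using assms by (auto intro: bounded_bilinear.continuous_on)
next
  case (Suc k)
  show ?case
  proof (rule C_k_on_SucI[OF Suc.prems(1) bounded_bilinear.FDERIV[OF assms
          C_k_on_has_derivative[OF Suc.prems(2)] C_k_on_has_derivative[OF Suc.prems(3)]]])
    fix v
    show "C_k_on k U (\<lambda>x. h (f x) (frechet_derivative g (at x) v)
        + h (frechet_derivative f (at x) v) (g x))"
      using Suc C_k_on_Suc_imp[OF Suc.prems(2)] C_k_on_Suc_imp[OF Suc.prems(3)]
      by (intro C_k_on_add Suc.IH) auto
  qed
qed

lemma C_k_on_sum:
  assumes "open U"
  shows "(\<And>i. i \<in> I \<Longrightarrow> C_k_on k U (f i)) \<Longrightarrow> C_k_on k U (\<lambda>x. \<Sum>i\<in>I. f i x)"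
  by (induction I rule: infinite_finite_induct)
    (simp_all add: C_k_on_const[OF assms] C_k_on_add[OF assms])

text \<open>The derivative of 1/f contains 1/f again, so the induction is on the order of 1/f
  itself: the previous order and the product rule give the next one.\<close>

lemma C_k_on_inverse:
  fixes f :: "'a::euclidean_space \<Rightarrow> real"
  assumes "open U" "\<And>x. x \<in> U \<Longrightarrow> f x \<noteq> 0"
  shows "C_k_on k U f \<Longrightarrow> C_k_on k U (\<lambda>x. inverse (f x))"
proof (induction k)
  case 0
  then show ?case using assms by (simp add: continuous_on_inverse)
next
  case (Suc k)
  have k: "C_k_on k U (\<lambda>x. inverse (f x))"
    by (rule Suc.IH[OF C_k_on_Suc_imp[OF Suc.prems]])
  show ?case
  proof (rule C_k_on_SucI[OF assms(1) Deriv.has_derivative_inverse[OF assms(2) C_k_on_has_derivative[OF Suc.prems]]])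
    fix v
    have "C_k_on k U (\<lambda>x. inverse (f x) * frechet_derivative f (at x) v * inverse (f x))"
      using Suc.prems k
      by (intro C_k_on_bounded_bilinear[OF bounded_bilinear_mult assms(1)]) auto
    then show "C_k_on k U (\<lambda>x. - (inverse (f x) * frechet_derivative f (at x) v * inverse (f x)))"
      by (intro C_k_on_bounded_linear[OF bounded_linear_minus[OF bounded_linear_ident] assms(1)])
  qed
qed

text \<open>Reduces a varying linear map applied to a varying vector to a finite sum of products,
  each factor of which is evaluated in a fixed direction.\<close>

lemma linear_Basis_expand:
  fixes D :: "'b::euclidean_space \<Rightarrow> 'c::real_vector"
  assumes "linear D"
  shows "D v = (\<Sum>b\<in>Basis. (v \<bullet> b) *\<^sub>R D b)"
proof -
  have "D v = D (\<Sum>b\<in>Basis. (v \<bullet> b) *\<^sub>R b)" by (simp add: euclidean_representation)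
  also have "\<dots> = (\<Sum>b\<in>Basis. (v \<bullet> b) *\<^sub>R D b)"
    using assms by (simp add: linear_sum linear_scale)
  finally show ?thesis .
qed

text \<open>\<open>C_k_on\<close> controls derivatives in fixed directions only, whereas the chain
  rule feeds the varying direction Dg(x)v into Df. Expanding that direction in \<open>Basis\<close>
  leaves products of functions to which the induction hypothesis and the product rule apply.\<close>

lemma C_k_on_compose:
  fixes f :: "'b::euclidean_space \<Rightarrow> 'c::real_normed_vector"
    and g :: "'a::euclidean_space \<Rightarrow> 'b"
  assumes "open U" "open V" "g ` U \<subseteq> V"
  shows "C_k_on k V f \<Longrightarrow> C_k_on k U g \<Longrightarrow> C_k_on k U (\<lambda>x. f (g x))"
proof (induction k arbitrary: f)
  case 0
  then show ?case using assms(3) continuous_on_compose2[of V f U g] by simp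
next
  case (Suc k)
  have fd: "(f has_derivative frechet_derivative f (at (g x))) (at (g x))" if "x \<in> U" for x
    using C_k_on_has_derivative[OF Suc.prems(1)] assms(3) that by auto
  have gd: "(g has_derivative frechet_derivative g (at x)) (at x)" if "x \<in> U" for x
    using C_k_on_has_derivative[OF Suc.prems(2) that] .
  show ?case
  proof (rule C_k_on_SucI[OF assms(1)])
    fix x assume x: "x \<in> U"
    show "((\<lambda>x. f (g x)) has_derivative
        (\<lambda>v. frechet_derivative f (at (g x)) (frechet_derivative g (at x) v))) (at x)"
      by (rule has_derivative_compose[OF gd[OF x] fd[OF x]])
  next
    fix v
    have "C_k_on k U (\<lambda>x. \<Sum>b\<in>Basis. (frechet_derivative g (at x) v \<bullet> b) *\<^sub>R
        frechet_derivative f (at (g x)) b)"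
    proof (intro C_k_on_sum[OF assms(1)] C_k_on_bounded_bilinear[OF bounded_bilinear_scaleR assms(1)])
      fix b :: 'b
      show "C_k_on k U (\<lambda>x. frechet_derivative g (at x) v \<bullet> b)"
        by (rule C_k_on_bounded_linear[OF bounded_linear_inner_left assms(1)])
          (use Suc.prems in auto)
      show "C_k_on k U (\<lambda>x. frechet_derivative f (at (g x)) b)"
        using Suc.IH[of "\<lambda>y. frechet_derivative f (at y) b"] Suc.prems(1) C_k_on_Suc_imp[OF Suc.prems(2)]
        by simp
    qed
    then show "C_k_on k U (\<lambda>x. frechet_derivative f (at (g x)) (frechet_derivative g (at x) v))"
      by (rule C_k_on_cong[OF assms(1), rotated])
        (simp add: linear_Basis_expand[OF has_derivative_linear[OF fd], symmetric])
  qed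
qed

section \<open>Closure properties of smooth maps\<close>

lemma smooth_on_const: "open U \<Longrightarrow> smooth_on U (\<lambda>x. c)"
  unfolding smooth_on_def by (simp add: C_k_on_const)

lemma smooth_on_add:
  "open U \<Longrightarrow> smooth_on U f \<Longrightarrow> smooth_on U g \<Longrightarrow> smooth_on U (\<lambda>x. f x + g x)"
  unfolding smooth_on_def by (simp add: C_k_on_add)

lemma smooth_on_bounded_linear:
  "open U \<Longrightarrow> bounded_linear h \<Longrightarrow> smooth_on U f \<Longrightarrow> smooth_on U (\<lambda>x. h (f x))"
  unfolding smooth_on_def by (simp add: C_k_on_bounded_linear)

lemma smooth_on_bounded_bilinear:
  "open U \<Longrightarrow> bounded_bilinear h \<Longrightarrow> smooth_on U f \<Longrightarrow> smooth_on U g \<Longrightarrow>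
    smooth_on U (\<lambda>x. h (f x) (g x))"
  unfolding smooth_on_def by (simp add: C_k_on_bounded_bilinear)

lemma smooth_on_sum:
  "open U \<Longrightarrow> (\<And>i. i \<in> I \<Longrightarrow> smooth_on U (F i)) \<Longrightarrow> smooth_on U (\<lambda>x. \<Sum>i\<in>I. F i x)"
  unfolding smooth_on_def by (simp add: C_k_on_sum)

lemma smooth_on_cong:
  assumes "open U" "\<And>x. x \<in> U \<Longrightarrow> f x = g x" "smooth_on U f"
  shows "smooth_on U g"
  using assms(3) C_k_on_cong[OF assms(1,2)] unfolding smooth_on_def by simp

lemma smooth_on_subset: "smooth_on U f \<Longrightarrow> T \<subseteq> U \<Longrightarrow> smooth_on T f"
  unfolding smooth_on_def using C_k_on_subset[of _ U f T] by simp

lemma smooth_on_local: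
  assumes "\<And>x. x \<in> U \<Longrightarrow> \<exists>T. open T \<and> x \<in> T \<and> smooth_on T f"
  shows "smooth_on U f"
  unfolding smooth_on_def
proof
  fix k
  show "C_k_on k U f"
    by (rule C_k_on_local) (use assms in \<open>unfold smooth_on_def, blast\<close>)
qed

lemma smooth_on_inverse:
  fixes f :: "'a::euclidean_space \<Rightarrow> real"
  assumes "open U" "\<And>x. x \<in> U \<Longrightarrow> f x \<noteq> 0" "smooth_on U f"
  shows "smooth_on U (\<lambda>x. inverse (f x))"
  using assms(3) C_k_on_inverse[OF assms(1,2)] unfolding smooth_on_def by simp

lemma smooth_on_compose:
  fixes f :: "'b::euclidean_space \<Rightarrow> 'c::real_normed_vector"
    and g :: "'a::euclidean_space \<Rightarrow> 'b"
  assumes "open U" "open V" "g ` U \<subseteq> V" "smooth_on V f" "smooth_on U g"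
  shows "smooth_on U (\<lambda>x. f (g x))"
  unfolding smooth_on_def
proof
  fix k
  show "C_k_on k U (\<lambda>x. f (g x))"
    by (rule C_k_on_compose[OF assms(1-3)]) (use assms(4,5) in \<open>simp_all add: smooth_on_def\<close>)
qed

lemma smooth_on_has_derivative:
  assumes "smooth_on U f" "x \<in> U"
  shows "(f has_derivative frechet_derivative f (at x)) (at x)"
  using assms(1) C_k_on_has_derivative[OF _ assms(2)] unfolding smooth_on_def by blast

lemma smooth_on_frechet_derivative:
  assumes "smooth_on U f"
  shows "smooth_on U (\<lambda>x. frechet_derivative f (at x) v)"
  unfolding smooth_on_def
proof
  fix k
  have "C_k_on (Suc k) U f" using assms unfolding smooth_on_def by blast
  then show "C_k_on k U (\<lambda>x. frechet_derivative f (at x) v)" by simp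
qed

lemma smooth_on_ident:
  assumes "open U"
  shows "smooth_on U (\<lambda>x. x)"
proof -
  have "C_k_on k U (\<lambda>x. x)" for k
  proof (cases k)
    case (Suc j)
    show ?thesis unfolding Suc
      by (rule C_k_on_SucI[OF assms has_derivative_ident C_k_on_const[OF assms]])
  qed simp
  then show ?thesis unfolding smooth_on_def by blast
qed

lemma smooth_on_scaleR:
  "open U \<Longrightarrow> smooth_on U c \<Longrightarrow> smooth_on U f \<Longrightarrow> smooth_on U (\<lambda>x. c x *\<^sub>R f x)"
  by (rule smooth_on_bounded_bilinear[OF _ bounded_bilinear_scaleR])

lemma smooth_on_inner:
  "open U \<Longrightarrow> smooth_on U f \<Longrightarrow> smooth_on U g \<Longrightarrow> smooth_on U (\<lambda>x. f x \<bullet> g x)"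
  by (rule smooth_on_bounded_bilinear[OF _ bounded_bilinear_inner])

lemma smooth_on_diff:
  assumes "open U" "smooth_on U f" "smooth_on U g"
  shows "smooth_on U (\<lambda>x. f x - g x)"
  using smooth_on_add[OF assms(1,2) smooth_on_bounded_linear[OF assms(1)
        bounded_linear_minus[OF bounded_linear_ident] assms(3)]] by simp

lemma smooth_on_divide:
  fixes f g :: "'a::euclidean_space \<Rightarrow> real"
  assumes "open U" "smooth_on U f" "smooth_on U g" "\<And>x. x \<in> U \<Longrightarrow> g x \<noteq> 0"
  shows "smooth_on U (\<lambda>x. f x / g x)"
  using smooth_on_bounded_bilinear[OF assms(1) bounded_bilinear_mult assms(2)
      smooth_on_inverse[OF assms(1) assms(4) assms(3)]]
  by (simp add: divide_inverse)

lemma smooth_map_smooth_on: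
  assumes "smooth_map U f"
    and "open U"
  shows "smooth_on U f"
proof (rule smooth_on_local)
  fix x assume "x \<in> U"
  then obtain T F where T: "open T" "x \<in> T" "smooth_on T F" "\<forall>y\<in>T \<inter> U. F y = f y"
    using assms(1) unfolding smooth_map_def by blast
  have "smooth_on (T \<inter> U) f"
    by (rule smooth_on_cong[where f = F]) (use T assms(2) in \<open>auto intro: smooth_on_subset\<close>)
  then show "\<exists>T. open T \<and> x \<in> T \<and> smooth_on T f"
    using T assms(2) \<open>x \<in> U\<close> by (intro exI[of _ "T \<inter> U"]) auto
qed

lemma smooth_on_smooth_map: "smooth_on U f \<Longrightarrow> open U \<Longrightarrow> M \<subseteq> U \<Longrightarrow> smooth_map M f"
  unfolding smooth_map_def by blast

subsection \<open>Bump functions\<close>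

text \<open>For \<open>p = 1\<close> this is the classical function exp(-1/t), extended by zero,
  that is flat at 0. The polynomial parameter makes the family closed under differentiation, so that
  smoothness follows by one induction over all \<open>p\<close>.\<close>

definition flat_exp :: "real poly \<Rightarrow> real \<Rightarrow> real" where
  "flat_exp p t = (if 0 < t then poly p (1 / t) * exp (- (1 / t)) else 0)"

lemma tendsto_poly_times_exp_neg: "((\<lambda>s::real. poly p s * exp (- s)) \<longlongrightarrow> 0) at_top"
proof -
  have "((\<lambda>s. \<Sum>i\<le>degree p. coeff p i * (s ^ i / exp s)) \<longlongrightarrow> (\<Sum>i\<le>degree p. coeff p i * 0)) at_top"
    by (intro tendsto_intros tendsto_power_div_exp_0)
  then show ?thesis
    by (simp add: poly_altdef sum_divide_distrib exp_minus field_simps)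
qed

text \<open>With s = 1/t one has ds/dt = -s^2, so p(s) exp(-s) has the derivative s^2 (p(s) - p'(s))
  exp(-s); the factor \<open>[:0, 0, 1:]\<close> is s^2.\<close>

lemma flat_exp_has_field_derivative:
  "(flat_exp p has_field_derivative flat_exp ([:0, 0, 1:] * (p - pderiv p)) t) (at t)"
proof -
  consider "t > 0" | "t < 0" | "t = 0" by linarith
  then show ?thesis
  proof cases
    case 1
    have d: "((\<lambda>t. 1 / t) has_field_derivative - (1 / t)\<^sup>2) (at t)"
      using 1 by (auto intro!: derivative_eq_intros simp: power2_eq_square)
    have "((\<lambda>t. poly p (1 / t) * exp (- (1 / t))) has_field_derivative
        poly (pderiv p) (1 / t) * (- (1 / t)\<^sup>2) * exp (- (1 / t))
        + exp (- (1 / t)) * - (- (1 / t)\<^sup>2) * poly p (1 / t)) (at t)"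
      by (rule DERIV_mult[OF DERIV_chain2[OF poly_DERIV d]
            DERIV_chain2[OF DERIV_exp DERIV_minus[OF d]]])
    then have "((\<lambda>t. poly p (1 / t) * exp (- (1 / t))) has_field_derivative
        flat_exp ([:0, 0, 1:] * (p - pderiv p)) t) (at t)"
      by (rule DERIV_cong)
        (use 1 in \<open>simp add: flat_exp_def power2_eq_square algebra_simps\<close>)
    then show ?thesis
      by (rule has_field_derivative_transform_within_open[of _ _ _ "{0<..}"])
        (use 1 in \<open>simp_all add: flat_exp_def\<close>)
  next
    case 2
    show ?thesis
      by (rule has_field_derivative_transform_within_open[of "\<lambda>t. 0" _ _ "{..<0}"])
        (use 2 in \<open>simp_all add: flat_exp_def\<close>)
  next
    case 3
    \<comment> \<open>The difference quotient at 0 from the right is s p(s) exp(-s) with s = 1/t,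
      and \<open>pCons 0 p\<close> is the polynomial s p(s).\<close>
    have "((\<lambda>s. poly (pCons 0 p) s * exp (- s)) \<longlongrightarrow> 0) at_top"
      by (rule tendsto_poly_times_exp_neg)
    then have "((\<lambda>t. poly (pCons 0 p) (inverse t) * exp (- inverse t)) \<longlongrightarrow> 0) (at_right 0)"
      by (rule filterlim_compose[OF _ filterlim_inverse_at_top_right])
    then have R: "((\<lambda>h. flat_exp p h / h) \<longlongrightarrow> 0) (at_right 0)"
      by (rule Lim_transform_eventually)
        (auto simp: flat_exp_def field_simps eventually_at_filter)
    have L: "((\<lambda>h. flat_exp p h / h) \<longlongrightarrow> 0) (at_left 0)"
      by (rule Lim_transform_eventually[OF tendsto_const])
        (auto simp: flat_exp_def eventually_at_filter)
    have "((\<lambda>h. flat_exp p h / h) \<longlongrightarrow> 0) (at 0)"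
      using L R by (simp add: filterlim_split_at)
    then show ?thesis using 3 by (simp add: DERIV_def flat_exp_def)
  qed
qed

lemma smooth_on_flat_exp: "smooth_on UNIV (flat_exp p)"
proof -
  have "C_k_on k UNIV (flat_exp p)" for k
  proof (induction k arbitrary: p)
    case 0
    then show ?case
      by (auto intro!: continuous_at_imp_continuous_on DERIV_isCont flat_exp_has_field_derivative)
  next
    case (Suc k)
    show ?case
      by (rule C_k_on_SucI[where D = "\<lambda>x v. flat_exp ([:0, 0, 1:] * (p - pderiv p)) x * v"])
        (use flat_exp_has_field_derivative[of p] Suc in
          \<open>auto simp: has_field_derivative_def
            intro!: C_k_on_bounded_linear[OF bounded_linear_mult_left]\<close>)
  qed
  then show ?thesis unfolding smooth_on_def by blast
qed

lemma flat_exp_1: "0 \<le> flat_exp 1 t" "0 < flat_exp 1 t \<longleftrightarrow> 0 < t" "flat_exp 1 t = 0 \<longleftrightarrow> t \<le> 0"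
  by (auto simp: flat_exp_def)

text \<open>The quotient a/(a+b), where \<open>a\<close> is positive inside radius r and
  \<open>b\<close> outside radius r/2; the two regions cover the space, so the denominator never
  vanishes. The closed set \<open>C\<close> inside \<open>U\<close> is what makes extension by zero
  across the boundary of \<open>U\<close> smooth.\<close>

lemma smooth_bump:
  fixes p :: "'a::euclidean_space"
  assumes "open U" "p \<in> U"
  obtains \<beta> :: "'a \<Rightarrow> real" and T C where "smooth_on UNIV \<beta>" "open T" "p \<in> T" "T \<subseteq> U"
    "\<And>x. x \<in> T \<Longrightarrow> \<beta> x = 1" "closed C" "C \<subseteq> U" "\<And>x. x \<notin> C \<Longrightarrow> \<beta> x = 0"
proof -
  obtain r where r: "r > 0" "cball p r \<subseteq> U" using assms open_contains_cball by metis
  \<comment> \<open>The squared distance, since the distance itself is not differentiable at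
    \<open>p\<close>.\<close>
  define d where "d x = (x - p) \<bullet> (x - p)" for x
  define a where "a x = flat_exp 1 (r\<^sup>2 - d x)" for x
  define b where "b x = flat_exp 1 (d x - (r / 2)\<^sup>2)" for x
  have d: "smooth_on UNIV d"
    unfolding d_def by (intro smooth_on_inner smooth_on_diff smooth_on_ident smooth_on_const open_UNIV)
  have a: "smooth_on UNIV a" unfolding a_def
    by (rule smooth_on_compose[OF _ open_UNIV _ smooth_on_flat_exp])
      (auto intro!: smooth_on_diff d smooth_on_const)
  have b: "smooth_on UNIV b" unfolding b_def
    by (rule smooth_on_compose[OF _ open_UNIV _ smooth_on_flat_exp])
      (auto intro!: smooth_on_diff d smooth_on_const)
  have pos: "a x + b x > 0" for x
  proof (cases "d x < r\<^sup>2")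
    case True
    then show ?thesis unfolding a_def b_def using flat_exp_1 by (simp add: add_pos_nonneg)
  next
    case False
    have "(r / 2)\<^sup>2 < r\<^sup>2" using r(1) by (simp add: power2_eq_square)
    then show ?thesis using False unfolding a_def b_def using flat_exp_1
      by (simp add: add_nonneg_pos)
  qed
  have dn: "d x = (dist p x)\<^sup>2" for x
    unfolding d_def dist_norm norm_minus_commute[of p] by (simp add: power2_norm_eq_inner)
  show ?thesis
  proof (rule that[of "\<lambda>x. a x / (a x + b x)" "ball p (r / 2)" "cball p r"])
    show "smooth_on UNIV (\<lambda>x. a x / (a x + b x))"
      using pos by (intro smooth_on_divide smooth_on_add a b) (auto simp: less_imp_neq[symmetric])
    show "a x / (a x + b x) = 1" if "x \<in> ball p (r / 2)" for x
    proof -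
      have "d x \<le> (r / 2)\<^sup>2" unfolding dn using that by (intro power_mono) auto
      then have "b x = 0" unfolding b_def using flat_exp_1(3) by simp
      then show ?thesis using pos[of x] by simp
    qed
    show "a x / (a x + b x) = 0" if "x \<notin> cball p r" for x
    proof -
      have "r\<^sup>2 \<le> d x" unfolding dn using that r(1) by (intro power_mono) auto
      then show ?thesis unfolding a_def using flat_exp_1(3) by simp
    qed
    have "ball p (r / 2) \<subseteq> cball p r" using r(1) by (auto)
    then show "ball p (r / 2) \<subseteq> U" using r(2) by blast
  qed (use r in auto)
qed

text \<open>The last two conclusions say that \<open>G\<close> is pointwise a multiple of
  \<open>F\<close> or zero. Hence \<open>G\<close> takes values in every family of subspaces in
  which \<open>F\<close> does, which keeps extended fields tangent to a submanifold.\<close>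

lemma smooth_germ_extension:
  fixes F :: "'a::euclidean_space \<Rightarrow> 'b::real_normed_vector"
  assumes "open U" "p \<in> U" "smooth_on U F"
  obtains G \<beta> T where "smooth_on UNIV G" "open T" "p \<in> T" "T \<subseteq> U"
    "\<And>x. x \<in> T \<Longrightarrow> G x = F x" "\<And>x. x \<in> U \<Longrightarrow> G x = \<beta> x *\<^sub>R F x" "\<And>x. x \<notin> U \<Longrightarrow> G x = 0"
proof -
  obtain \<beta> :: "'a \<Rightarrow> real" and T C where \<beta>: "smooth_on UNIV \<beta>" "open T" "p \<in> T" "T \<subseteq> U"
    "\<And>x. x \<in> T \<Longrightarrow> \<beta> x = 1" "closed C" "C \<subseteq> U" "\<And>x. x \<notin> C \<Longrightarrow> \<beta> x = 0"
    using smooth_bump[OF assms(1,2)] by metis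
  define G where "G x = (if x \<in> U then \<beta> x *\<^sub>R F x else 0)" for x
  have "smooth_on UNIV G"
  proof (rule smooth_on_local)
    fix x
    show "\<exists>T. open T \<and> x \<in> T \<and> smooth_on T G"
    proof (cases "x \<in> U")
      case True
      have "smooth_on U G"
        by (rule smooth_on_cong[OF assms(1) _ smooth_on_scaleR[OF assms(1)
                smooth_on_subset[OF \<beta>(1)] assms(3)]]) (auto simp: G_def)
      then show ?thesis using True assms(1) by blast
    next
      case False
      have "smooth_on (- C) G"
        by (rule smooth_on_cong[OF _ _ smooth_on_const[of _ 0]]) (use \<beta> in \<open>auto simp: G_def\<close>)
      then show ?thesis using False \<beta>(6,7) by (intro exI[of _ "- C"]) auto
    qed
  qed
  then show ?thesis
    by (rule that[of G T \<beta>]) (use \<beta> in \<open>auto simp: G_def\<close>)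
qed

subsection \<open>Smooth solution of linear systems\<close>

lemma smooth_on_linear_family:
  fixes \<omega> :: "'a::euclidean_space \<Rightarrow> 'b::euclidean_space \<Rightarrow> 'c::real_normed_vector"
  assumes U: "open U" and lin: "\<And>q. q \<in> U \<Longrightarrow> linear (\<omega> q)"
    and sm: "\<And>y. smooth_on U (\<lambda>q. \<omega> q y)" and Y: "smooth_on U Y"
  shows "smooth_on U (\<lambda>q. \<omega> q (Y q))"
proof -
  have "smooth_on U (\<lambda>q. \<Sum>b\<in>Basis. (Y q \<bullet> b) *\<^sub>R \<omega> q b)"
    by (intro smooth_on_sum smooth_on_scaleR smooth_on_inner smooth_on_const U Y sm)
  then show ?thesis
    by (rule smooth_on_cong[OF U, rotated]) (rule linear_Basis_expand[OF lin, symmetric])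
qed

lemma smooth_on_bilinear_family:
  fixes b :: "'a::euclidean_space \<Rightarrow> 'b::euclidean_space \<Rightarrow> 'c::euclidean_space \<Rightarrow> 'd::real_normed_vector"
  assumes U: "open U" and bil: "\<And>q. q \<in> U \<Longrightarrow> bilinear (b q)"
    and sm: "\<And>x y. smooth_on U (\<lambda>q. b q x y)" and X: "smooth_on U X" and Y: "smooth_on U Y"
  shows "smooth_on U (\<lambda>q. b q (X q) (Y q))"
proof (rule smooth_on_linear_family[OF U _ _ Y])
  show "linear (b q (X q))" if "q \<in> U" for q using bil[OF that] by (simp add: bilinear_def)
  show "smooth_on U (\<lambda>q. b q (X q) y)" for y
    by (rule smooth_on_linear_family[OF U _ sm X]) (use bil in \<open>simp add: bilinear_def\<close>)
qed

text \<open>Gram-Schmidt with smooth parameters. The functional stays arbitrary in the induction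
  because the hypothesis is used twice: for the given one, and for \<open>b q (l n q)\<close>, whose
  representer \<open>P\<close> is the orthogonal projection of the new frame vector onto the span of
  the earlier ones. The difference \<open>e\<close> is orthogonal to that span and nonzero by
  independence.\<close>

lemma smooth_riesz_representer:
  fixes b :: "'a::euclidean_space \<Rightarrow> 'b::euclidean_space \<Rightarrow> 'b \<Rightarrow> real"
    and l :: "nat \<Rightarrow> 'a \<Rightarrow> 'b" and n :: nat
  assumes U: "open U" and bil: "\<And>q. q \<in> U \<Longrightarrow> bilinear (b q)"
    and sym: "\<And>q x y. q \<in> U \<Longrightarrow> b q x y = b q y x"
    and pos: "\<And>q x. q \<in> U \<Longrightarrow> x \<noteq> 0 \<Longrightarrow> 0 < b q x x"
    and sm: "\<And>x y. smooth_on U (\<lambda>q. b q x y)"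
    and frame: "\<And>i. i < n \<Longrightarrow> smooth_on U (l i)"
    and indep: "\<And>q i. q \<in> U \<Longrightarrow> i < n \<Longrightarrow> l i q \<notin> span ((\<lambda>j. l j q) ` {..<i})"
    and \<omega>: "\<And>q. q \<in> U \<Longrightarrow> linear (\<omega> q)" "\<And>y. smooth_on U (\<lambda>q. \<omega> q y)"
  shows "\<exists>R. smooth_on U R \<and> (\<forall>q\<in>U. R q \<in> span ((\<lambda>j. l j q) ` {..<n}) \<and>
    (\<forall>y\<in>span ((\<lambda>j. l j q) ` {..<n}). b q (R q) y = \<omega> q y))"
  using frame indep \<omega>
proof (induction n arbitrary: \<omega>)
  case 0
  then show ?case
    by (intro exI[of _ "\<lambda>_. 0"]) (simp add: smooth_on_const[OF U] linear_0 bilinear_lzero[OF bil])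
next
  case (Suc n)
  define E where "E q = span ((\<lambda>j. l j q) ` {..<n})" for q
  have ln: "smooth_on U (l n)" using Suc.prems(1) by simp
  obtain R where R: "smooth_on U R" "\<And>q. q \<in> U \<Longrightarrow> R q \<in> E q"
    "\<And>q y. q \<in> U \<Longrightarrow> y \<in> E q \<Longrightarrow> b q (R q) y = \<omega> q y"
    using Suc.IH[of \<omega>] Suc.prems unfolding E_def by auto
  have "\<exists>P. smooth_on U P \<and> (\<forall>q\<in>U. P q \<in> E q \<and> (\<forall>y\<in>E q. b q (P q) y = b q (l n q) y))"
    unfolding E_def
  proof (rule Suc.IH)
    show "linear (b q (l n q))" if "q \<in> U" for q using bil[OF that] by (simp add: bilinear_def)
    show "smooth_on U (\<lambda>q. b q (l n q) y)" for y
      by (rule smooth_on_bilinear_family[OF U bil sm ln smooth_on_const[OF U]])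
  qed (use Suc.prems in simp_all)
  then obtain P where P: "smooth_on U P" "\<And>q. q \<in> U \<Longrightarrow> P q \<in> E q"
    "\<And>q y. q \<in> U \<Longrightarrow> y \<in> E q \<Longrightarrow> b q (P q) y = b q (l n q) y"
    by blast
  define e where "e q = l n q - P q" for q
  have e: "smooth_on U e" unfolding e_def by (intro smooth_on_diff U ln P)
  have e_pos: "0 < b q (e q) (e q)" if "q \<in> U" for q
  proof (rule pos[OF that])
    show "e q \<noteq> 0" using P(2)[OF that] Suc.prems(2)[OF that, of n] unfolding e_def E_def by auto
  qed
  have e_orth: "b q (e q) y = 0" if "q \<in> U" "y \<in> E q" for q y
    using P(3)[OF that] unfolding e_def by (simp add: bilinear_lsub[OF bil[OF that(1)]])
  \<comment> \<open>\<open>R\<close> is orthogonal to \<open>e\<close>, so the coefficient of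
    \<open>e\<close> is forced by the requirement b(R', e) = \<omega>(e).\<close>
  define R' where "R' q = R q + (\<omega> q (e q) / b q (e q) (e q)) *\<^sub>R e q" for q
  have "b q (e q) (e q) \<noteq> 0" if "q \<in> U" for q using e_pos[OF that] by simp
  then have "smooth_on U R'" unfolding R'_def
    by (intro smooth_on_add[OF U R(1)] smooth_on_scaleR[OF U _ e] smooth_on_divide[OF U]
        smooth_on_linear_family[OF U Suc.prems(3,4) e] smooth_on_bilinear_family[OF U bil sm e e])
  moreover have "R' q \<in> span ((\<lambda>j. l j q) ` {..<Suc n})" if "q \<in> U" for q
  proof -
    have "E q \<subseteq> span ((\<lambda>j. l j q) ` {..<Suc n})" unfolding E_def by (rule span_mono) auto
    moreover have "l n q \<in> span ((\<lambda>j. l j q) ` {..<Suc n})" by (rule span_base) auto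
    ultimately show ?thesis unfolding R'_def e_def
      using R(2)[OF that] P(2)[OF that] by (auto intro!: span_add span_diff span_scale)
  qed
  moreover have "b q (R' q) y = \<omega> q y" if q: "q \<in> U" and y: "y \<in> span ((\<lambda>j. l j q) ` {..<Suc n})" for q y
  proof -
    have "(\<lambda>j. l j q) ` {..<Suc n} = insert (l n q) ((\<lambda>j. l j q) ` {..<n})"
      by (simp add: lessThan_Suc)
    then obtain k where k: "y - k *\<^sub>R l n q \<in> E q"
      using y unfolding E_def by (auto simp: span_insert)
    define x where "x = y - k *\<^sub>R e q"
    have "x = (y - k *\<^sub>R l n q) + k *\<^sub>R P q" unfolding x_def e_def by (simp add: algebra_simps)
    then have x: "x \<in> E q"
      using k P(2)[OF q] unfolding E_def by (metis span_add span_scale)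
    have y: "y = k *\<^sub>R e q + x" unfolding x_def by simp
    note B = bilinear_ladd[OF bil[OF q]] bilinear_radd[OF bil[OF q]]
      bilinear_lmul[OF bil[OF q]] bilinear_rmul[OF bil[OF q]]
    have "b q (R q) (e q) = 0" using e_orth[OF q R(2)[OF q]] sym[OF q] by metis
    then have "b q (R' q) y = k * \<omega> q (e q) + \<omega> q x"
      unfolding y R'_def using e_orth[OF q x] e_pos[OF q] R(3)[OF q x] by (simp add: B)
    also have "\<dots> = \<omega> q y"
      unfolding y using Suc.prems(3)[OF q] by (simp add: linear_add linear_scale)
    finally show ?thesis .
  qed
  ultimately show ?case by blast
qed

text \<open>Independence in ordered form, each vector outside the span of its predecessors, is what
  an inductive orthogonalisation consumes.\<close>

lemma independent_enumeration:
  fixes B :: "'a::euclidean_space set"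
  assumes "independent B"
  obtains bs where "bij_betw bs {..<card B} B"
    "\<And>i. i < card B \<Longrightarrow> bs i \<notin> span (bs ` {..<i})"
proof -
  have "finite B" using assms by (rule independent_imp_finite)
  then obtain bs where bs: "bij_betw bs {..<card B} B"
    using ex_bij_betw_nat_finite by (metis atLeast0LessThan)
  have "bs i \<notin> span (bs ` {..<i})" if i: "i < card B" for i
  proof
    assume "bs i \<in> span (bs ` {..<i})"
    moreover have "bs ` {..<i} \<subseteq> B - {bs i}"
      using bs i unfolding bij_betw_def inj_on_def by fastforce
    ultimately have "bs i \<in> span (B - {bs i})" using span_mono by blast
    moreover have "bs i \<in> B" using bs i unfolding bij_betw_def by auto
    ultimately show False using assms unfolding dependent_def by blast
  qed
  then show ?thesis using that bs by blast
qed

text \<open>The solution of \<open>F q x = z q\<close> represents the functional \<open>y \<mapsto> z q \<bullet> F q y\<close> with respect to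
  the inner product \<open>(x, y) \<mapsto> F q x \<bullet> F q y\<close>.\<close>

lemma smooth_linear_solve:
  fixes F :: "'a::euclidean_space \<Rightarrow> 'b::euclidean_space \<Rightarrow> 'b"
  assumes U: "open U" and lin: "\<And>q. q \<in> U \<Longrightarrow> linear (F q)" and inj: "\<And>q. q \<in> U \<Longrightarrow> inj (F q)"
    and sm: "\<And>y. smooth_on U (\<lambda>q. F q y)" and z: "smooth_on U z"
  obtains R where "smooth_on U R" "\<And>q. q \<in> U \<Longrightarrow> F q (R q) = z q"
proof -
  obtain bs where bs: "bij_betw bs {..<card (Basis :: 'b set)} (Basis :: 'b set)"
    "\<And>i. i < card (Basis :: 'b set) \<Longrightarrow> bs i \<notin> span (bs ` {..<i})"
    using independent_enumeration[OF independent_Basis[where 'a = 'b]] by metis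
  have UN: "span (bs ` {..<card (Basis :: 'b set)}) = UNIV"
    using bs(1) unfolding bij_betw_def by (simp add: span_Basis)
  have "\<exists>R. smooth_on U R \<and> (\<forall>q\<in>U. R q \<in> span ((\<lambda>j. bs j) ` {..<card (Basis :: 'b set)}) \<and>
    (\<forall>y\<in>span ((\<lambda>j. bs j) ` {..<card (Basis :: 'b set)}). F q (R q) \<bullet> F q y = z q \<bullet> F q y))"
  proof (rule smooth_riesz_representer[where b = "\<lambda>q x y. F q x \<bullet> F q y" and l = "\<lambda>j q. bs j"
        and \<omega> = "\<lambda>q y. z q \<bullet> F q y", OF U])
    fix q assume q: "q \<in> U"
    show "bilinear (\<lambda>x y. F q x \<bullet> F q y)" "linear (\<lambda>y. z q \<bullet> F q y)"
      unfolding bilinear_def using lin[OF q]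
      by (auto intro!: linearI simp: linear_add linear_scale inner_add_left inner_add_right)
    show "0 < F q x \<bullet> F q x" if "x \<noteq> 0" for x
      using inj[OF q] linear_injective_0[OF lin[OF q]] that by auto
  qed (use bs(2) sm z U in \<open>simp_all add: inner_commute smooth_on_inner smooth_on_const\<close>)
  then obtain R where R: "smooth_on U R" "\<And>q y. q \<in> U \<Longrightarrow> F q (R q) \<bullet> F q y = z q \<bullet> F q y"
    using UN by auto
  have "F q (R q) = z q" if q: "q \<in> U" for q
  proof -
    \<comment> \<open>By surjectivity the residual is itself a value of \<open>F q\<close>; testing
      the normal equation with its preimage shows that the residual has norm zero.\<close>
    obtain y where y: "F q y = F q (R q) - z q"
      using linear_injective_imp_surjective[OF lin[OF q] inj[OF q]] by (metis surjD)
    have "(F q (R q) - z q) \<bullet> (F q (R q) - z q) = 0"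
      using R(2)[OF q, of y] unfolding y inner_diff_left by simp
    then show ?thesis by simp
  qed
  then show ?thesis using that R(1) by blast
qed

subsection \<open>Tangent spaces and local frames\<close>

lemma tangent_space_open:
  assumes "open U" "p \<in> U"
  shows "tangent_space U p = UNIV"
proof -
  have "curve_at U p v (\<lambda>t. p + t *\<^sub>R v)" for v
  proof -
    have "((\<lambda>t. p + t *\<^sub>R v) \<longlongrightarrow> p + 0 *\<^sub>R v) (at 0)" by (intro tendsto_intros)
    then have "\<forall>\<^sub>F t in at 0. p + t *\<^sub>R v \<in> U"
      using assms by (intro topological_tendstoD) auto
    then obtain e where e: "e > 0" "\<And>t. t \<noteq> 0 \<Longrightarrow> dist t 0 < e \<Longrightarrow> p + t *\<^sub>R v \<in> U"
      unfolding eventually_at by auto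
    have "p + t *\<^sub>R v \<in> U" if "t \<in> {-e<..<e}" for t
      using e(2)[of t] assms(2) that by (cases "t = 0") auto
    moreover have "smooth_on {-e<..<e} (\<lambda>t. p + t *\<^sub>R v)"
      by (intro smooth_on_add smooth_on_const smooth_on_scaleR smooth_on_ident) auto
    moreover have "((\<lambda>t. p + t *\<^sub>R v) has_vector_derivative v) (at 0)"
      by (auto intro!: derivative_eq_intros simp: has_vector_derivative_def)
    ultimately show ?thesis unfolding curve_at_def using e(1) by auto
  qed
  then show ?thesis unfolding tangent_space_def by blast
qed

lemma curve_at_eventually:
  assumes "curve_at M p v c" "open T" "p \<in> T"
  shows "\<forall>\<^sub>F t in nhds 0. c t \<in> T \<inter> M"
proof -
  obtain e where e: "e > 0" "c ` {-e<..<e} \<subseteq> M" using assms(1) unfolding curve_at_def by auto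
  have "isCont c 0" using assms(1) unfolding curve_at_def
    by (auto intro: has_vector_derivative_continuous)
  then have "\<forall>\<^sub>F t in nhds 0. c t \<in> T"
    using assms unfolding curve_at_def
    by (auto simp: continuous_at_open eventually_nhds)
  moreover have "\<forall>\<^sub>F t in nhds 0. t \<in> {-e<..<e}"
    by (rule eventually_nhds_in_open) (use e in auto)
  ultimately show ?thesis by eventually_elim (use e(2) in auto)
qed

lemma curve_at_chain:
  assumes "curve_at M p v c" "(F has_derivative D) (at p)"
  shows "((\<lambda>t. F (c t)) has_vector_derivative D v) (at 0)"
proof -
  have "(c has_derivative (\<lambda>t. t *\<^sub>R v)) (at 0)" "c 0 = p"
    using assms(1) unfolding curve_at_def has_vector_derivative_def by auto
  then have "((\<lambda>t. F (c t)) has_derivative (\<lambda>t. D (t *\<^sub>R v))) (at 0)"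
    using has_derivative_compose[of c _ 0 UNIV F D] assms(2) by simp
  then show ?thesis
    unfolding has_vector_derivative_def
    by (simp add: linear_scale[OF has_derivative_linear[OF assms(2)]])
qed

text \<open>Makes the description in \<open>tderiv\<close> proper: by the chain rule every curve
  with velocity \<open>v\<close> gives the value \<open>D v\<close>, and since \<open>v\<close> is
  tangent there is such a curve, which forces uniqueness. Any ambient \<open>F\<close> that agrees
  with \<open>u\<close> on \<open>M\<close> near \<open>p\<close> may be used.\<close>

lemma tderiv_eq:
  assumes "v \<in> tangent_space M p" "open T" "p \<in> T" "(F has_derivative D) (at p)"
    "\<And>x. x \<in> T \<inter> M \<Longrightarrow> F x = u x"
  shows "tderiv M u p v = D v"
proof -
  have d: "((\<lambda>t. u (c t)) has_real_derivative D v) (at 0)" if c: "curve_at M p v c" for c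
  proof -
    have ev: "\<forall>\<^sub>F t in nhds 0. F (c t) = u (c t)"
      using curve_at_eventually[OF c assms(2,3)] by eventually_elim (rule assms(5))
    have "((\<lambda>t. F (c t)) has_real_derivative D v) (at 0)"
      using curve_at_chain[OF c assms(4)] by (simp add: has_real_derivative_iff_has_vector_derivative)
    then show ?thesis using DERIV_cong_ev[OF refl ev refl] by blast
  qed
  obtain c where c: "curve_at M p v c" using assms(1) unfolding tangent_space_def by blast
  show ?thesis unfolding tderiv_def
    by (rule the_equality) (use d c DERIV_unique in blast)+
qed

text \<open>In a slice chart the tangent space is the image of the model subspace under the derivative of
  the inverse chart; a curve in the submanifold stays in the model subspace, hence so does its
  velocity.\<close>

lemma embedded_submanifold_local_frame:
  assumes "embedded_submanifold S M" "p \<in> M"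
  obtains T n l where "open T" "p \<in> T" "T \<subseteq> S"
    "\<And>i. i < n \<Longrightarrow> smooth_on T (l i)"
    "\<And>q i. q \<in> T \<Longrightarrow> i < n \<Longrightarrow> l i q \<notin> span ((\<lambda>j. l j q) ` {..<(i::nat)})"
    "\<And>q. q \<in> T \<inter> M \<Longrightarrow> tangent_space M q = span ((\<lambda>j. l j q) ` {..<n})"
proof -
  obtain k where "\<And>q. q \<in> M \<Longrightarrow> \<exists>U (\<phi> :: 'a \<Rightarrow> 'a) \<psi> (L :: 'a set).
      open U \<and> q \<in> U \<and> U \<subseteq> S \<and> smooth_on U \<phi> \<and> open (\<phi> ` U) \<and> smooth_on (\<phi> ` U) \<psi> \<and>
      (\<forall>x\<in>U. \<psi> (\<phi> x) = x) \<and> subspace L \<and> dim L = k \<and> \<phi> ` (U \<inter> M) = \<phi> ` U \<inter> L"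
    using assms(1)[unfolded embedded_submanifold_def, THEN conjunct2]
    by (elim exE) (rule that, erule bspec)
  from this[OF assms(2)] obtain U and \<phi> \<psi> :: "'a \<Rightarrow> 'a" and L where U: "open U" "p \<in> U" "U \<subseteq> S" and \<phi>: "smooth_on U \<phi>"
    and oV: "open (\<phi> ` U)" and \<psi>: "smooth_on (\<phi> ` U) \<psi>" "\<And>x. x \<in> U \<Longrightarrow> \<psi> (\<phi> x) = x"
    and L: "subspace L" "\<phi> ` (U \<inter> M) = \<phi> ` U \<inter> L"
    by (elim exE conjE) (rule that, (assumption | erule bspec)+)
  define D where "D q = frechet_derivative \<psi> (at (\<phi> q))" for q
  define D' where "D' q = frechet_derivative \<phi> (at q)" for q
  have D: "(\<psi> has_derivative D q) (at (\<phi> q))" if "q \<in> U" for q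
    unfolding D_def by (rule smooth_on_has_derivative[OF \<psi>(1)]) (use that in auto)
  have D': "(\<phi> has_derivative D' q) (at q)" if "q \<in> U" for q
    unfolding D'_def by (rule smooth_on_has_derivative[OF \<phi> that])
  have DD': "D q (D' q v) = v" if q: "q \<in> U" for q v
  proof -
    have "((\<lambda>x. \<psi> (\<phi> x)) has_derivative (\<lambda>v. D q (D' q v))) (at q)"
      by (rule has_derivative_compose[OF D'[OF q] D[OF q]])
    moreover have "((\<lambda>x. \<psi> (\<phi> x)) has_derivative (\<lambda>v. v)) (at q)"
      by (subst has_derivative_cong_open[OF U(1) q \<psi>(2)]) (auto intro: has_derivative_ident)
    ultimately have "(\<lambda>v. D q (D' q v)) = (\<lambda>v. v)" by (rule has_derivative_unique)
    then show ?thesis by metis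
  qed
  have D'D: "D' q (D q v) = v" if q: "q \<in> U" for q v
  proof -
    have "(\<phi> has_derivative D' q) (at (\<psi> (\<phi> q)))" using D'[OF q] \<psi>(2)[OF q] by simp
    then have "((\<lambda>y. \<phi> (\<psi> y)) has_derivative (\<lambda>v. D' q (D q v))) (at (\<phi> q))"
      by (rule has_derivative_compose[OF D[OF q]])
    moreover have "((\<lambda>y. \<phi> (\<psi> y)) has_derivative (\<lambda>v. v)) (at (\<phi> q))"
      by (subst has_derivative_cong_open[OF oV, of _ _ "\<lambda>y. y"])
        (use q \<psi>(2) in \<open>auto intro: has_derivative_ident\<close>)
    ultimately have "(\<lambda>v. D' q (D q v)) = (\<lambda>v. v)" by (rule has_derivative_unique)
    then show ?thesis by metis
  qed
  have D_lin: "linear (D q)" if "q \<in> U" for q using D[OF that] by (rule has_derivative_linear)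
  have D_inj: "inj (D q)" if "q \<in> U" for q using D'D[OF that] by (metis injI)
  have tangent: "tangent_space M q = D q ` L" if q: "q \<in> U \<inter> M" for q
  proof (intro equalityI subsetI)
    fix v assume "v \<in> tangent_space M q"
    then obtain c where c: "curve_at M q v c" unfolding tangent_space_def by blast
    \<comment> \<open>Membership in \<open>L\<close> is tested against each \<open>w\<close>
      orthogonal to \<open>L\<close>: along the curve the product with \<open>w\<close> is
      identically zero, hence so is its derivative.\<close>
    have "D' q v \<in> orthogonal_comp (orthogonal_comp L)"
      unfolding orthogonal_comp_def
    proof (safe)
      fix w assume w: "\<forall>x\<in>L. orthogonal x w"
      have d: "((\<lambda>x. \<phi> x \<bullet> w) has_derivative (\<lambda>v. D' q v \<bullet> w)) (at q)"
        using D' q by (intro has_derivative_inner_left) auto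
      have ev: "\<forall>\<^sub>F t in nhds 0. \<phi> (c t) \<bullet> w = 0"
      proof (rule eventually_mono)
        show "\<forall>\<^sub>F t in nhds 0. c t \<in> U \<inter> M"
          by (rule curve_at_eventually[OF c U(1)]) (use q in auto)
        fix t assume "c t \<in> U \<inter> M"
        then have "\<phi> (c t) \<in> L" using L(2) by blast
        then show "\<phi> (c t) \<bullet> w = 0" using w unfolding orthogonal_def by blast
      qed
      have "((\<lambda>t. \<phi> (c t) \<bullet> w) has_real_derivative D' q v \<bullet> w) (at 0)"
        using curve_at_chain[OF c d] by (simp add: has_real_derivative_iff_has_vector_derivative)
      then have "((\<lambda>t. 0) has_real_derivative D' q v \<bullet> w) (at 0)"
        using DERIV_cong_ev[OF refl ev refl] by blast
      then have "D' q v \<bullet> w = 0" using DERIV_unique DERIV_const by blast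
      then show "orthogonal w (D' q v)" by (simp add: orthogonal_def inner_commute)
    qed
    then have "D' q v \<in> L" using orthogonal_comp_self[OF L(1)] by simp
    then show "v \<in> D q ` L" using DD'[of q v] q by (metis IntD1 image_eqI)
  next
    fix v assume "v \<in> D q ` L"
    then obtain y where y: "y \<in> L" "v = D q y" by blast
    \<comment> \<open>A straight line in the model subspace, to be pulled back to \<open>M\<close>
      by the inverse chart.\<close>
    define c' where "c' t = \<phi> q + t *\<^sub>R y" for t
    have "((\<lambda>t. \<phi> q + t *\<^sub>R y) \<longlongrightarrow> \<phi> q + 0 *\<^sub>R y) (at 0)" by (intro tendsto_intros)
    then have "\<forall>\<^sub>F t in at 0. \<phi> q + t *\<^sub>R y \<in> \<phi> ` U"
      using oV q by (intro topological_tendstoD) auto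
    then obtain e where e: "e > 0" "\<And>t. t \<noteq> 0 \<Longrightarrow> dist t 0 < e \<Longrightarrow> c' t \<in> \<phi> ` U"
      unfolding eventually_at c'_def by auto
    have cU: "c' t \<in> \<phi> ` U" if "t \<in> {-e<..<e}" for t
      using e(2)[of t] q that by (cases "t = 0") (auto simp: c'_def)
    have cM: "\<psi> (c' t) \<in> M" if t: "t \<in> {-e<..<e}" for t
    proof -
      have "\<phi> q \<in> L" using q L(2) by blast
      then have "c' t \<in> L" unfolding c'_def using y(1) L(1) by (auto intro: subspace_add subspace_scale)
      then obtain x where "x \<in> U \<inter> M" "c' t = \<phi> x" using cU[OF t] L(2) by blast
      then show ?thesis using \<psi>(2) by auto
    qed
    have "smooth_on {-e<..<e} c'" unfolding c'_def
      by (intro smooth_on_add smooth_on_const smooth_on_scaleR smooth_on_ident) auto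
    then have "smooth_on {-e<..<e} (\<lambda>t. \<psi> (c' t))"
      by (intro smooth_on_compose[OF _ oV _ \<psi>(1)]) (use cU in auto)
    moreover have "(c' has_derivative (\<lambda>t. t *\<^sub>R y)) (at 0)"
      unfolding c'_def by (auto intro!: derivative_eq_intros)
    then have "((\<lambda>t. \<psi> (c' t)) has_derivative (\<lambda>t. D q (t *\<^sub>R y))) (at 0)"
      by (rule has_derivative_compose) (use D q in \<open>simp add: c'_def\<close>)
    then have "((\<lambda>t. \<psi> (c' t)) has_vector_derivative v) (at 0)"
      unfolding has_vector_derivative_def y(2) using linear_scale[OF D_lin] q by simp
    moreover have "\<psi> (c' 0) = q" using q \<psi>(2) by (simp add: c'_def)
    ultimately have "curve_at M q v (\<lambda>t. \<psi> (c' t))"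
      unfolding curve_at_def using e(1) cM by auto
    then show "v \<in> tangent_space M q" unfolding tangent_space_def by blast
  qed
  \<comment> \<open>A basis of the model subspace, pushed forward by \<open>D q\<close>, is the
    frame. The formula makes sense on all of \<open>U\<close>, so the frame is smooth and
    independent off \<open>M\<close> too.\<close>
  obtain B where B: "B \<subseteq> L" "independent B" "L \<subseteq> span B" using basis_exists by metis
  obtain bs where bs: "bij_betw bs {..<card B} B" "\<And>i. i < card B \<Longrightarrow> bs i \<notin> span (bs ` {..<i})"
    using independent_enumeration[OF B(2)] by metis
  have spanB: "span B = L" using B L(1) by (simp add: span_minimal subset_antisym)
  show ?thesis
  proof (rule that[of U "card B" "\<lambda>i q. D q (bs i)"])
    show "smooth_on U (\<lambda>q. D q (bs i))" for i
      unfolding D_def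
      by (rule smooth_on_compose[OF U(1) oV _ smooth_on_frechet_derivative[OF \<psi>(1)] \<phi>]) auto
    show "D q (bs i) \<notin> span ((\<lambda>j. D q (bs j)) ` {..<i})" if q: "q \<in> U" and i: "i < card B" for q i
    proof
      have "(\<lambda>j. D q (bs j)) ` {..<i} = D q ` (bs ` {..<i})" by auto
      moreover assume "D q (bs i) \<in> span ((\<lambda>j. D q (bs j)) ` {..<i})"
      ultimately have "D q (bs i) \<in> D q ` span (bs ` {..<i})"
        using linear_span_image[OF D_lin[OF q]] by metis
      then have "bs i \<in> span (bs ` {..<i})" using D_inj[OF q] by (metis inj_image_mem_iff)
      then show False using bs(2)[OF i] by blast
    qed
    show "tangent_space M q = span ((\<lambda>j. D q (bs j)) ` {..<card B})" if q: "q \<in> U \<inter> M" for q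
    proof -
      have "(\<lambda>j. D q (bs j)) ` {..<card B} = D q ` B"
        using bs unfolding bij_betw_def by (metis image_image)
      then show ?thesis
        using tangent[OF q] linear_span_image[OF D_lin, of q B] spanB q by simp
    qed
  qed (use U in auto)
qed

lemma embedded_submanifold_subspace:
  assumes "embedded_submanifold S M" "p \<in> M"
  shows "subspace (tangent_space M p)"
  using embedded_submanifold_local_frame[OF assms] assms(2) by (metis IntI subspace_span)

text \<open>Lets the results on gradients along \<open>M\<close> be instantiated with
  \<open>M = S\<close>, which gives the properties of \<open>grad S g f\<close>.\<close>

lemma embedded_submanifold_refl:
  assumes "open S"
  shows "embedded_submanifold S S"
  unfolding embedded_submanifold_def
proof (intro conjI exI[of _ "DIM('a)"] ballI)
  fix p assume "p \<in> S"
  then show "\<exists>U (\<phi> :: 'a \<Rightarrow> 'a) \<psi> (L :: 'a set). open U \<and> p \<in> U \<and> U \<subseteq> S \<and> smooth_on U \<phi> \<and>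
      open (\<phi> ` U) \<and> smooth_on (\<phi> ` U) \<psi> \<and> (\<forall>x\<in>U. \<psi> (\<phi> x) = x) \<and>
      subspace L \<and> dim L = DIM('a) \<and> \<phi> ` (U \<inter> S) = \<phi> ` U \<inter> L"
    using assms smooth_on_ident[OF assms]
    by (intro exI[of _ S] exI[of _ "\<lambda>x. x"] exI[of _ UNIV]) simp
qed simp

subsection \<open>The Koszul and Gauss formulas\<close>

lemma vector_fields_local:
  assumes "V \<in> vector_fields M" "p \<in> M"
  obtains T F where "open T" "p \<in> T" "smooth_on T F" "\<And>x. x \<in> T \<inter> M \<Longrightarrow> F x = V x"
  using assms unfolding vector_fields_def smooth_map_def by blast

lemma vector_fields_tangent: "V \<in> vector_fields M \<Longrightarrow> p \<in> M \<Longrightarrow> V p \<in> tangent_space M p"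
  unfolding vector_fields_def by blast

lemma vector_fields_open:
  assumes "open U"
  shows "V \<in> vector_fields U \<longleftrightarrow> smooth_on U V"
  using assms tangent_space_open[OF assms] smooth_map_smooth_on smooth_on_smooth_map
  unfolding vector_fields_def by blast

lemma affine_connection_vector_field:
  "affine_connection M nab \<Longrightarrow> V \<in> vector_fields M \<Longrightarrow> W \<in> vector_fields M \<Longrightarrow>
    nab V W \<in> vector_fields M"
  unfolding affine_connection_def by (drule conjunct1) simp

lemma affine_connection_linear:
  assumes "affine_connection M nab" "V \<in> vector_fields M" "V' \<in> vector_fields M"
    "W \<in> vector_fields M" "smooth_map M a" "smooth_map M b" "p \<in> M"
  shows "nab (\<lambda>q. a q *\<^sub>R V q + b q *\<^sub>R V' q) W p = a p *\<^sub>R nab V W p + b p *\<^sub>R nab V' W p"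
  by (rule assms(1)[unfolded affine_connection_def, THEN conjunct2, THEN conjunct2, THEN conjunct1,
        rule_format]) (use assms in auto)

text \<open>On an open set every field is a combination of the constant fields of
  \<open>Basis\<close> with its components as smooth coefficients. Linearity over smooth functions
  then expresses the value at \<open>p\<close> through \<open>V p\<close> alone.\<close>

lemma affine_connection_pointwise:
  assumes S: "open S" "p \<in> S" and nab: "affine_connection S nab"
    and VW: "V \<in> vector_fields S" "V' \<in> vector_fields S" "W \<in> vector_fields S" "V p = V' p"
  shows "nab V W p = nab V' W p"
proof -
  have c: "(\<lambda>q. b) \<in> vector_fields S" for b
    using S by (simp add: vector_fields_open smooth_on_const)
  have "nab X W p = (\<Sum>b\<in>Basis. (X p \<bullet> b) *\<^sub>R nab (\<lambda>q. b) W p)" if X: "X \<in> vector_fields S" for X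
  proof -
    have X': "smooth_on S (\<lambda>q. X q \<bullet> b)" for b
      using X S by (simp add: vector_fields_open smooth_on_const smooth_on_inner)
    have "nab (\<lambda>q. \<Sum>b\<in>B. (X q \<bullet> b) *\<^sub>R b) W p = (\<Sum>b\<in>B. (X p \<bullet> b) *\<^sub>R nab (\<lambda>q. b) W p)"
      if "finite B" for B
      using that
    proof induction
      case empty
      show ?case
        using affine_connection_linear[OF nab c c VW(3), of "\<lambda>_. 0" "\<lambda>_. 0" p 0 0] S
        by (simp add: smooth_on_smooth_map[OF smooth_on_const])
    next
      case (insert b B)
      have "(\<lambda>q. \<Sum>b\<in>B. (X q \<bullet> b) *\<^sub>R b) \<in> vector_fields S"
        using S X' by (simp add: vector_fields_open smooth_on_sum smooth_on_scaleR smooth_on_const)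
      then show ?case
        using affine_connection_linear[OF nab c _ VW(3), of "\<lambda>q. \<Sum>b\<in>B. (X q \<bullet> b) *\<^sub>R b"
            "\<lambda>q. X q \<bullet> b" "\<lambda>_. 1" p b] S X' insert
        by (simp add: smooth_on_smooth_map[OF smooth_on_const] smooth_on_smooth_map[OF X'])
    qed
    from this[OF finite_Basis] show ?thesis by (simp add: euclidean_representation)
  qed
  then show ?thesis using VW by simp
qed

text \<open>Torsion-freeness is tested on the linear functions x \<mapsto> x \<bullet> b. Their
  derivative along a field is a component of that field, so the iterated derivatives become first
  derivatives of components and the bracket becomes the flat one, for any ambient extensions
  \<open>F\<close> and \<open>G\<close>.\<close>

lemma torsion_free_bracket:
  fixes V W :: "'a::euclidean_space \<Rightarrow> 'a"
  assumes tf: "torsion_free M nab" and nab: "affine_connection M nab"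
    and sub: "subspace (tangent_space M p)"
    and VW: "V \<in> vector_fields M" "W \<in> vector_fields M" and p: "p \<in> M"
    and T: "open T" "p \<in> T" and F: "smooth_on T F" "smooth_on T G"
    and eq: "\<And>x. x \<in> T \<inter> M \<Longrightarrow> F x = V x" "\<And>x. x \<in> T \<inter> M \<Longrightarrow> G x = W x"
  shows "nab V W p - nab W V p
    = frechet_derivative G (at p) (V p) - frechet_derivative F (at p) (W p)"
proof (rule euclidean_eqI)
  fix b :: 'a
  have td: "tderiv M (\<lambda>x. x \<bullet> b) q v = v \<bullet> b" if "v \<in> tangent_space M q" for q v
    by (rule tderiv_eq[OF that open_UNIV]) (auto intro!: derivative_eq_intros)
  have td2: "tderiv M (\<lambda>q. tderiv M (\<lambda>x. x \<bullet> b) q (X q)) p v = frechet_derivative H (at p) v \<bullet> b"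
    if "X \<in> vector_fields M" "smooth_on T H" "\<And>x. x \<in> T \<inter> M \<Longrightarrow> H x = X x"
      "v \<in> tangent_space M p" for X H v
  proof (rule tderiv_eq[OF that(4) T])
    show "((\<lambda>x. H x \<bullet> b) has_derivative (\<lambda>v. frechet_derivative H (at p) v \<bullet> b)) (at p)"
      by (rule has_derivative_inner_left[OF smooth_on_has_derivative[OF that(2) T(2)]])
    show "H x \<bullet> b = tderiv M (\<lambda>x. x \<bullet> b) x (X x)" if "x \<in> T \<inter> M" for x
      using that td vector_fields_tangent \<open>X \<in> vector_fields M\<close>
        \<open>\<And>x. x \<in> T \<inter> M \<Longrightarrow> H x = X x\<close> by (metis IntD2)
  qed
  have "smooth_map M (\<lambda>x. x \<bullet> b)"
    by (rule smooth_on_smooth_map[of UNIV]) (auto intro!: smooth_on_inner smooth_on_ident smooth_on_const)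
  then have "tderiv M (\<lambda>x. x \<bullet> b) p (nab V W p - nab W V p)
      = tderiv M (\<lambda>q. tderiv M (\<lambda>x. x \<bullet> b) q (W q)) p (V p)
        - tderiv M (\<lambda>q. tderiv M (\<lambda>x. x \<bullet> b) q (V q)) p (W p)"
    using tf VW p unfolding torsion_free_def by blast
  moreover have "nab V W p - nab W V p \<in> tangent_space M p"
    by (intro subspace_diff[OF sub] vector_fields_tangent[OF affine_connection_vector_field[OF nab]] VW p)
  ultimately show "(nab V W p - nab W V p) \<bullet> b
      = (frechet_derivative G (at p) (V p) - frechet_derivative F (at p) (W p)) \<bullet> b"
    using td td2[OF VW(1) F(1) eq(1) vector_fields_tangent[OF VW(2) p]]
      td2[OF VW(2) F(2) eq(2) vector_fields_tangent[OF VW(1) p]]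
    by (simp add: inner_diff_left)
qed

text \<open>The classical expression for 2 g(\<nabla>V W, Z), with each Lie bracket replaced by its
  flat formula. It refers neither to a connection nor to a submanifold.\<close>

definition koszul :: "'a::euclidean_space metric_tensor \<Rightarrow> 'a \<Rightarrow> ('a \<Rightarrow> 'a) \<Rightarrow> ('a \<Rightarrow> 'a) \<Rightarrow> ('a \<Rightarrow> 'a) \<Rightarrow> real"
  where "koszul g p V W Z =
    frechet_derivative (\<lambda>q. g q (W q) (Z q)) (at p) (V p)
    + frechet_derivative (\<lambda>q. g q (V q) (Z q)) (at p) (W p)
    - frechet_derivative (\<lambda>q. g q (V q) (W q)) (at p) (Z p)
    + g p (frechet_derivative W (at p) (V p) - frechet_derivative V (at p) (W p)) (Z p)
    - g p (frechet_derivative Z (at p) (V p) - frechet_derivative V (at p) (Z p)) (W p)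
    - g p (frechet_derivative Z (at p) (W p) - frechet_derivative W (at p) (Z p)) (V p)"

section \<open>Metrics on an open set: uniqueness and locality of the Levi-Civita connection\<close>

locale riemannian_open =
  fixes S :: "'a::euclidean_space set" and g :: "'a metric_tensor"
  assumes open_S: "open S"
    and bilinear_g: "p \<in> S \<Longrightarrow> bilinear (g p)"
    and sym_g: "p \<in> S \<Longrightarrow> g p v w = g p w v"
    and pos_g: "p \<in> S \<Longrightarrow> v \<noteq> 0 \<Longrightarrow> 0 < g p v v"
    and smooth_g: "smooth_on S (\<lambda>p. g p v w)"
begin

lemmas g_simps = bilinear_ladd[OF bilinear_g] bilinear_radd[OF bilinear_g]
  bilinear_lmul[OF bilinear_g] bilinear_rmul[OF bilinear_g]
  bilinear_lsub[OF bilinear_g] bilinear_rsub[OF bilinear_g]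
  bilinear_lzero[OF bilinear_g] bilinear_rzero[OF bilinear_g]

text \<open>Testing with \<open>u - v\<close> suffices. This is the uniqueness half for local
  connections, projections, gradients and the Weingarten map.\<close>

lemma g_nondegenerate:
  assumes "p \<in> S" "subspace E" "u \<in> E" "v \<in> E" "\<And>w. w \<in> E \<Longrightarrow> g p u w = g p v w"
  shows "u = v"
proof (rule ccontr)
  assume "u \<noteq> v"
  then have "0 < g p (u - v) (u - v)" using pos_g[OF assms(1)] by simp
  moreover have "g p (u - v) (u - v) = g p u (u - v) - g p v (u - v)"
    using assms(1) by (simp only: g_simps)
  moreover have "u - v \<in> E" using assms by (simp add: subspace_diff)
  ultimately show False using assms(5) by simp
qed

lemma smooth_on_g:
  assumes "open T" "T \<subseteq> S" "smooth_on T X" "smooth_on T Y"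
  shows "smooth_on T (\<lambda>q. g q (X q) (Y q))"
  by (rule smooth_on_bilinear_family[OF assms(1) _ _ assms(3,4)])
    (use assms(2) bilinear_g smooth_on_subset[OF smooth_g] in auto)

text \<open>Compatibility for the three cyclic derivatives and torsion-freeness for the three
  brackets; by symmetry of \<open>g\<close> all that survives is twice the wanted product. Because
  the extensions to \<open>T\<close> are arbitrary, one right-hand side can serve a submanifold and
  the ambient set at once.\<close>

lemma koszul_formula:
  assumes M: "M \<subseteq> S" "p \<in> M" and sub: "subspace (tangent_space M p)"
    and lc: "levi_civita M g nab"
    and VWZ: "V \<in> vector_fields M" "W \<in> vector_fields M" "Z \<in> vector_fields M"
    and T: "open T" "p \<in> T" and sm: "smooth_on T V'" "smooth_on T W'" "smooth_on T Z'"
    and eq: "\<And>x. x \<in> T \<inter> M \<Longrightarrow> V' x = V x" "\<And>x. x \<in> T \<inter> M \<Longrightarrow> W' x = W x"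
      "\<And>x. x \<in> T \<inter> M \<Longrightarrow> Z' x = Z x"
  shows "2 * g p (nab V W p) (Z p) = koszul g p V' W' Z'"
proof -
  have nab: "affine_connection M nab" and tf: "torsion_free M nab" and mc: "metric_compatible M g nab"
    using lc unfolding levi_civita_def by auto
  have p: "p \<in> S" using M by auto
  have der: "frechet_derivative (\<lambda>q. g q (X' q) (Y' q)) (at p) v = tderiv M (\<lambda>q. g q (X q) (Y q)) p v"
    if "smooth_on T X'" "smooth_on T Y'" "\<And>x. x \<in> T \<inter> M \<Longrightarrow> X' x = X x"
      "\<And>x. x \<in> T \<inter> M \<Longrightarrow> Y' x = Y x" "v \<in> tangent_space M p" for X X' Y Y' v
  proof (rule tderiv_eq[OF that(5), symmetric])
    show "open (T \<inter> S)" "p \<in> T \<inter> S" using T M open_S by auto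
    have "smooth_on (T \<inter> S) (\<lambda>q. g q (X' q) (Y' q))"
      using T open_S by (intro smooth_on_g smooth_on_subset[OF that(1)] smooth_on_subset[OF that(2)]) auto
    then show "((\<lambda>q. g q (X' q) (Y' q)) has_derivative
        frechet_derivative (\<lambda>q. g q (X' q) (Y' q)) (at p)) (at p)"
      by (rule smooth_on_has_derivative) (use p T in auto)
  qed (use that(3,4) in auto)
  note tan = VWZ[THEN vector_fields_tangent, OF M(2)]
  have p': "V' p = V p" "W' p = W p" "Z' p = Z p" using eq T M by auto
  have c: "frechet_derivative (\<lambda>q. g q (X' q) (Y' q)) (at p) (U p)
      = g p (nab U X p) (Y p) + g p (X p) (nab U Y p)"
    if "smooth_on T X'" "smooth_on T Y'" "\<And>x. x \<in> T \<inter> M \<Longrightarrow> X' x = X x"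
      "\<And>x. x \<in> T \<inter> M \<Longrightarrow> Y' x = Y x"
      "X \<in> vector_fields M" "Y \<in> vector_fields M" "U \<in> vector_fields M" for X X' Y Y' U
    using der[OF that(1-4) vector_fields_tangent[OF that(7) M(2)]] mc that M(2)
    unfolding metric_compatible_def by simp
  note b = torsion_free_bracket[OF tf nab sub _ _ M(2) T, symmetric]
  have "frechet_derivative (\<lambda>q. g q (W' q) (Z' q)) (at p) (V p)
      = g p (nab V W p) (Z p) + g p (W p) (nab V Z p)"
    by (rule c[OF sm(2,3) eq(2,3) VWZ(2,3,1)])
  moreover have "frechet_derivative (\<lambda>q. g q (V' q) (Z' q)) (at p) (W p)
      = g p (nab W V p) (Z p) + g p (V p) (nab W Z p)"
    by (rule c[OF sm(1,3) eq(1,3) VWZ(1,3,2)])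
  moreover have "frechet_derivative (\<lambda>q. g q (V' q) (W' q)) (at p) (Z p)
      = g p (nab Z V p) (W p) + g p (V p) (nab Z W p)"
    by (rule c[OF sm(1,2) eq(1,2) VWZ(1,2,3)])
  moreover have "frechet_derivative W' (at p) (V p) - frechet_derivative V' (at p) (W p)
      = nab V W p - nab W V p"
    by (rule b[OF VWZ(1,2) sm(1,2) eq(1,2)])
  moreover have "frechet_derivative Z' (at p) (V p) - frechet_derivative V' (at p) (Z p)
      = nab V Z p - nab Z V p"
    by (rule b[OF VWZ(1,3) sm(1,3) eq(1,3)])
  moreover have "frechet_derivative Z' (at p) (W p) - frechet_derivative W' (at p) (Z p)
      = nab W Z p - nab Z W p"
    by (rule b[OF VWZ(2,3) sm(2,3) eq(2,3)])
  ultimately have "koszul g p V' W' Z' = g p (nab V W p) (Z p) + g p (W p) (nab V Z p)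
      + (g p (nab W V p) (Z p) + g p (V p) (nab W Z p))
      - (g p (nab Z V p) (W p) + g p (V p) (nab Z W p))
      + g p (nab V W p - nab W V p) (Z p) - g p (nab V Z p - nab Z V p) (W p)
      - g p (nab W Z p - nab Z W p) (V p)"
    unfolding koszul_def p' by simp
  then show ?thesis
    using sym_g[OF p] by (simp add: g_simps p)
qed

text \<open>Two admissible pairs of global fields agree near \<open>p\<close>, so Koszul's formula
  with constant third field gives both connections the same products with every vector.\<close>

lemma local_connection_eq:
  assumes lc: "levi_civita S g nab" and p: "p \<in> S"
    and VW: "V \<in> vector_fields S" "W \<in> vector_fields S"
    and T: "open T" "p \<in> T" "\<And>q. q \<in> T \<inter> S \<Longrightarrow> V q = V' q" "\<And>q. q \<in> T \<inter> S \<Longrightarrow> W q = W' q"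
  shows "local_connection S nab V' W' p = nab V W p"
  unfolding local_connection_def
proof (rule the_equality)
  show "\<exists>V1\<in>vector_fields S. \<exists>W1\<in>vector_fields S. \<exists>T.
      open T \<and> p \<in> T \<and> (\<forall>q\<in>T \<inter> S. V1 q = V' q \<and> W1 q = W' q) \<and> nab V W p = nab V1 W1 p"
    using VW T by blast
next
  fix u
  assume "\<exists>V1\<in>vector_fields S. \<exists>W1\<in>vector_fields S. \<exists>T.
      open T \<and> p \<in> T \<and> (\<forall>q\<in>T \<inter> S. V1 q = V' q \<and> W1 q = W' q) \<and> u = nab V1 W1 p"
  then obtain V1 W1 T1 where V1: "V1 \<in> vector_fields S" "W1 \<in> vector_fields S" "open T1" "p \<in> T1"
    "\<And>q. q \<in> T1 \<inter> S \<Longrightarrow> V1 q = V' q \<and> W1 q = W' q" "u = nab V1 W1 p"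
    by blast
  have sub: "subspace (tangent_space S p)" using tangent_space_open[OF open_S p] by (simp add: subspace_UNIV)
  have sm: "smooth_on S V" "smooth_on S W" using VW vector_fields_open[OF open_S] by auto
  have "nab V1 W1 p = nab V W p"
  proof (rule g_nondegenerate[OF p subspace_UNIV])
    fix z
    have z: "(\<lambda>_. z) \<in> vector_fields S"
      by (simp add: vector_fields_open[OF open_S] smooth_on_const open_S)
    have N: "open (T \<inter> T1 \<inter> S)" "p \<in> T \<inter> T1 \<inter> S" using T V1 p open_S by auto
    have sm: "smooth_on (T \<inter> T1 \<inter> S) V" "smooth_on (T \<inter> T1 \<inter> S) W"
      using sm smooth_on_subset by blast+
    have "2 * g p (nab V1 W1 p) z = koszul g p V W (\<lambda>_. z)"
      by (rule koszul_formula[OF order_refl p sub lc V1(1,2) z N sm smooth_on_const[OF N(1)]])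
        (use T V1 in auto)
    moreover have "2 * g p (nab V W p) z = koszul g p V W (\<lambda>_. z)"
      by (rule koszul_formula[OF order_refl p sub lc VW z N sm smooth_on_const[OF N(1)]]) auto
    ultimately show "g p (nab V1 W1 p) z = g p (nab V W p) z" by simp
  qed auto
  then show "u = nab V W p" using V1(6) by simp
qed

end

section \<open>Global fields from germs and from single tangent vectors\<close>

lemma germ_vector_field:
  assumes "open S" "open U" "p \<in> U" "smooth_on U F"
  obtains G T where "G \<in> vector_fields S" "open T" "p \<in> T" "T \<subseteq> U" "\<And>x. x \<in> T \<Longrightarrow> G x = F x"
  using smooth_germ_extension[OF assms(2-4)] vector_fields_open[OF assms(1)] smooth_on_subset
  by (metis subset_UNIV)

text \<open>Extend \<open>w\<close> with constant coefficients along a local frame, then cut off.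
  Being smooth on the whole space, the result is a field on \<open>M\<close> and on any open set at
  the same time.\<close>

lemma vector_field_through_tangent_vector:
  assumes emb: "embedded_submanifold S M" and p: "p \<in> M" and w: "w \<in> tangent_space M p"
  obtains W where "smooth_on UNIV W" "W \<in> vector_fields M" "W p = w"
proof -
  obtain T n l where T: "open T" "p \<in> T" "\<And>i. i < n \<Longrightarrow> smooth_on T (l i)"
    "\<And>q. q \<in> T \<inter> M \<Longrightarrow> tangent_space M q = span ((\<lambda>j. l j q) ` {..<n::nat})"
    using embedded_submanifold_local_frame[OF emb p] by metis
  have "w \<in> span ((\<lambda>j. l j p) ` {..<n})" using T p w by auto
  then have "\<exists>F. smooth_on T F \<and> F p = w \<and> (\<forall>q\<in>T. F q \<in> span ((\<lambda>j. l j q) ` {..<n}))"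
  proof (induction rule: span_induct_alt)
    case base
    then show ?case by (intro exI[of _ "\<lambda>_. 0"]) (simp add: smooth_on_const T span_zero)
  next
    case (step c x y)
    then obtain j F where j: "j < n" "x = l j p" and F: "smooth_on T F" "F p = y"
      "\<forall>q\<in>T. F q \<in> span ((\<lambda>j. l j q) ` {..<n})" by blast
    show ?case
    proof (intro exI[of _ "\<lambda>q. c *\<^sub>R l j q + F q"] conjI ballI)
      show "smooth_on T (\<lambda>q. c *\<^sub>R l j q + F q)"
        using j F T by (intro smooth_on_add smooth_on_scaleR smooth_on_const) auto
      show "c *\<^sub>R l j q + F q \<in> span ((\<lambda>j. l j q) ` {..<n})" if "q \<in> T" for q
        using j(1) F(3) that by (intro span_add[OF span_scale[OF span_base]]) auto
    qed (use j F in simp)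
  qed
  then obtain F where F: "smooth_on T F" "F p = w"
    "\<And>q. q \<in> T \<inter> M \<Longrightarrow> F q \<in> tangent_space M q" using T(4) by auto
  from smooth_germ_extension[OF T(1,2) F(1)]
  obtain G \<beta> T' where G: "smooth_on UNIV G" "p \<in> T'" "\<And>x. x \<in> T' \<Longrightarrow> G x = F x"
    "\<And>x. x \<in> T \<Longrightarrow> G x = \<beta> x *\<^sub>R F x" "\<And>x. x \<notin> T \<Longrightarrow> G x = 0" by metis
  have "G q \<in> tangent_space M q" if "q \<in> M" for q
  proof (cases "q \<in> T")
    case True
    then show ?thesis using G(4) F(3) that embedded_submanifold_subspace[OF emb that]
      by (simp add: subspace_scale)
  next
    case False
    then show ?thesis using G(5) embedded_submanifold_subspace[OF emb that] by (simp add: subspace_0)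
  qed
  then have "G \<in> vector_fields M"
    unfolding vector_fields_def using smooth_on_smooth_map[OF G(1)] by auto
  then show ?thesis using that[of G] G F by auto
qed

section \<open>Projections, gradients and Hessians along a submanifold\<close>

locale riemannian_submanifold = riemannian_open S g
  for S :: "'a::euclidean_space set" and g +
  fixes M :: "'a set"
  assumes embedded: "embedded_submanifold S M"
begin

lemma M_subset: "M \<subseteq> S"
  using embedded unfolding embedded_submanifold_def by blast

lemma in_S: "p \<in> M \<Longrightarrow> p \<in> S"
  using M_subset by blast

lemma subspace_tangent: "p \<in> M \<Longrightarrow> subspace (tangent_space M p)"
  using embedded_submanifold_subspace[OF embedded] .

text \<open>Common source of tangential projections, with \<omega> the product with a fixed vector,
  and of gradients, with \<omega> the differential.\<close>

lemma local_representer: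
  assumes p: "p \<in> M" and U: "open U" "p \<in> U"
    and \<omega>: "\<And>q. q \<in> U \<Longrightarrow> linear (\<omega> q)" "\<And>y. smooth_on U (\<lambda>q. \<omega> q y)"
  obtains T R where "open T" "p \<in> T" "T \<subseteq> U \<inter> S" "smooth_on T R"
    "\<And>q. q \<in> T \<inter> M \<Longrightarrow> R q \<in> tangent_space M q"
    "\<And>q w. q \<in> T \<inter> M \<Longrightarrow> w \<in> tangent_space M q \<Longrightarrow> g q (R q) w = \<omega> q w"
proof -
  obtain T n l where T: "open T" "p \<in> T" "T \<subseteq> S" "\<And>i. i < n \<Longrightarrow> smooth_on T (l i)"
    "\<And>q i. q \<in> T \<Longrightarrow> i < n \<Longrightarrow> l i q \<notin> span ((\<lambda>j. l j q) ` {..<i})"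
    "\<And>q. q \<in> T \<inter> M \<Longrightarrow> tangent_space M q = span ((\<lambda>j. l j q) ` {..<n::nat})"
    using embedded_submanifold_local_frame[OF embedded p] by metis
  have "\<exists>R. smooth_on (T \<inter> U) R \<and> (\<forall>q\<in>T \<inter> U. R q \<in> span ((\<lambda>j. l j q) ` {..<n}) \<and>
      (\<forall>y\<in>span ((\<lambda>j. l j q) ` {..<n}). g q (R q) y = \<omega> q y))"
  proof (rule smooth_riesz_representer)
    show "open (T \<inter> U)" using T U by auto
    show "bilinear (g q)" "g q x y = g q y x" if "q \<in> T \<inter> U" for q x y
      using that T(3) bilinear_g sym_g by auto
    show "0 < g q x x" if "q \<in> T \<inter> U" "x \<noteq> 0" for q x using that T(3) pos_g by auto
    show "smooth_on (T \<inter> U) (\<lambda>q. g q x y)" for x y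
      using T(3) by (intro smooth_on_subset[OF smooth_g]) auto
    show "smooth_on (T \<inter> U) (l i)" if "i < n" for i
      by (rule smooth_on_subset[OF T(4)[OF that]]) auto
    show "smooth_on (T \<inter> U) (\<lambda>q. \<omega> q y)" for y by (rule smooth_on_subset[OF \<omega>(2)]) auto
  qed (use T(5) \<omega>(1) in auto)
  then obtain R where R: "smooth_on (T \<inter> U) R" "\<And>q. q \<in> T \<inter> U \<Longrightarrow> R q \<in> span ((\<lambda>j. l j q) ` {..<n})"
    "\<And>q y. q \<in> T \<inter> U \<Longrightarrow> y \<in> span ((\<lambda>j. l j q) ` {..<n}) \<Longrightarrow> g q (R q) y = \<omega> q y"
    by blast
  show ?thesis
    by (rule that[of "T \<inter> U" R]) (use T U R in auto)
qed

lemma tan_proj_eqI: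
  assumes p: "p \<in> M" and u: "u \<in> tangent_space M p"
    and eq: "\<And>w. w \<in> tangent_space M p \<Longrightarrow> g p u w = g p v w"
  shows "tan_proj g M p v = u"
  unfolding tan_proj_def orth_proj_def
proof (rule the_equality)
  show "u \<in> tangent_space M p \<and> (\<forall>w\<in>tangent_space M p. g p (v - u) w = 0)"
    using u eq by (simp add: g_simps in_S[OF p])
next
  fix u' assume u': "u' \<in> tangent_space M p \<and> (\<forall>w\<in>tangent_space M p. g p (v - u') w = 0)"
  show "u' = u"
    by (rule g_nondegenerate[OF in_S[OF p] subspace_tangent[OF p] _ u])
      (use u' eq in \<open>auto simp: g_simps in_S[OF p]\<close>)
qed

lemma tan_proj:
  assumes p: "p \<in> M"
  shows tan_proj_tangent: "tan_proj g M p v \<in> tangent_space M p"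
    and g_tan_proj: "w \<in> tangent_space M p \<Longrightarrow> g p (tan_proj g M p v) w = g p v w"
proof -
  have "linear (g q v)" if "q \<in> S" for q using bilinear_g[OF that] by (simp add: bilinear_def)
  from local_representer[OF p open_S in_S[OF p] this smooth_g]
  obtain T R where "p \<in> T" "\<And>q. q \<in> T \<inter> M \<Longrightarrow> R q \<in> tangent_space M q"
    "\<And>q w. q \<in> T \<inter> M \<Longrightarrow> w \<in> tangent_space M q \<Longrightarrow> g q (R q) w = g q v w" by metis
  then have R: "R p \<in> tangent_space M p" "\<And>w. w \<in> tangent_space M p \<Longrightarrow> g p (R p) w = g p v w"
    using p by auto
  have "tan_proj g M p v = R p" by (rule tan_proj_eqI[OF p R])
  then show "tan_proj g M p v \<in> tangent_space M p"
    "w \<in> tangent_space M p \<Longrightarrow> g p (tan_proj g M p v) w = g p v w" using R by auto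
qed

text \<open>The tangent space of \<open>S\<close> is everything, so the normal space is the whole
  orthogonal complement, and it contains what remains after removing the tangential part.\<close>

lemma nor_proj_eq:
  assumes p: "p \<in> M"
  shows "nor_proj S g M p v = v - tan_proj g M p v"
proof -
  let ?N = "normal_space S g M p"
  have N: "n \<in> ?N \<longleftrightarrow> (\<forall>w\<in>tangent_space M p. g p n w = 0)" for n
    unfolding normal_space_def using tangent_space_open[OF open_S in_S[OF p]] by auto
  have u: "v - tan_proj g M p v \<in> ?N"
    unfolding N using g_tan_proj[OF p] by (simp add: g_simps in_S[OF p])
  have o: "g p (tan_proj g M p v) w = 0" if "w \<in> ?N" for w
    using that tan_proj_tangent[OF p] sym_g[OF in_S[OF p]] unfolding N by metis
  have sub: "subspace ?N"
    by (rule subspaceI) (simp_all add: N g_simps in_S[OF p])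
  show ?thesis unfolding nor_proj_def orth_proj_def
  proof (rule the_equality)
    fix u' assume u': "u' \<in> ?N \<and> (\<forall>w\<in>?N. g p (v - u') w = 0)"
    show "u' = v - tan_proj g M p v"
    proof (rule g_nondegenerate[OF in_S[OF p] sub _ u])
      fix w assume "w \<in> ?N"
      then show "g p u' w = g p (v - tan_proj g M p v) w"
        using u' o[of w] by (simp add: g_simps in_S[OF p])
    qed (use u' in auto)
  qed (use u o in simp)
qed

lemma grad_eqI:
  assumes p: "p \<in> M" and U: "open U" "p \<in> U" and f: "(f has_derivative D) (at p)"
    and h: "\<And>x. x \<in> U \<inter> M \<Longrightarrow> f x = h x" and u: "u \<in> tangent_space M p"
    and eq: "\<And>w. w \<in> tangent_space M p \<Longrightarrow> g p u w = D w"
  shows "grad M g h p = u"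
proof -
  have td: "tderiv M h p w = D w" if "w \<in> tangent_space M p" for w
    by (rule tderiv_eq[OF that U f h])
  show ?thesis unfolding grad_def
  proof (rule the_equality)
    fix v assume v: "v \<in> tangent_space M p \<and> (\<forall>w\<in>tangent_space M p. g p v w = tderiv M h p w)"
    show "v = u"
      by (rule g_nondegenerate[OF in_S[OF p] subspace_tangent[OF p] _ u]) (use v eq td in auto)
  qed (use u eq td in auto)
qed

lemma grad_submanifold:
  assumes f: "smooth_on S f" and h: "\<And>x. x \<in> M \<Longrightarrow> f x = h x"
  shows grad_vector_field: "grad M g h \<in> vector_fields M"
    and g_grad: "p \<in> M \<Longrightarrow> w \<in> tangent_space M p \<Longrightarrow>
      g p (grad M g h p) w = frechet_derivative f (at p) w"
proof -
  have "\<exists>T R. open T \<and> p \<in> T \<and> smooth_on T R \<and> (\<forall>q\<in>T \<inter> M. grad M g h q = R q \<and>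
      R q \<in> tangent_space M q \<and>
      (\<forall>w\<in>tangent_space M q. g q (R q) w = frechet_derivative f (at q) w))" if p: "p \<in> M" for p
  proof -
    have d: "(f has_derivative frechet_derivative f (at q)) (at q)" if "q \<in> S" for q
      by (rule smooth_on_has_derivative[OF f that])
    obtain T R where T: "open T" "p \<in> T" "T \<subseteq> S \<inter> S" "smooth_on T R"
      "\<And>q. q \<in> T \<inter> M \<Longrightarrow> R q \<in> tangent_space M q"
      "\<And>q w. q \<in> T \<inter> M \<Longrightarrow> w \<in> tangent_space M q \<Longrightarrow> g q (R q) w = frechet_derivative f (at q) w"
      by (rule local_representer[where \<omega> = "\<lambda>q. frechet_derivative f (at q)", OF p open_S in_S[OF p]])
        (use d in \<open>auto intro: has_derivative_linear smooth_on_frechet_derivative[OF f]\<close>)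
    have "grad M g h q = R q" if q: "q \<in> T \<inter> M" for q
      by (rule grad_eqI[OF _ T(1) _ d]) (use q T h in auto)
    then show ?thesis using T by blast
  qed
  note * = this
  have "smooth_map M (grad M g h)"
    unfolding smooth_map_def using * by metis
  moreover have "grad M g h p \<in> tangent_space M p" if "p \<in> M" for p
    using *[OF that] that by auto
  ultimately show "grad M g h \<in> vector_fields M" unfolding vector_fields_def by blast
  show "g p (grad M g h p) w = frechet_derivative f (at p) w"
    if "p \<in> M" "w \<in> tangent_space M p" using *[OF that(1)] that by auto
qed

lemma gauss_formula:
  assumes nab: "levi_civita S g nab" and nabM: "levi_civita M g nabM" and p: "p \<in> M"
    and VW: "V \<in> vector_fields M" "W \<in> vector_fields M"
    and VW': "V' \<in> vector_fields S" "W' \<in> vector_fields S"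
    and T: "open T" "p \<in> T" "\<And>q. q \<in> T \<inter> M \<Longrightarrow> V' q = V q" "\<And>q. q \<in> T \<inter> M \<Longrightarrow> W' q = W q"
  shows "tan_proj g M p (nab V' W' p) = nabM V W p"
proof (rule tan_proj_eqI[OF p])
  show "nabM V W p \<in> tangent_space M p"
    using vector_fields_tangent[OF affine_connection_vector_field[OF _ VW] p] nabM
    unfolding levi_civita_def by simp
  fix w assume "w \<in> tangent_space M p"
  from vector_field_through_tangent_vector[OF embedded p this]
  obtain Z where Z: "smooth_on UNIV Z" "Z \<in> vector_fields M" "Z p = w" by metis
  have ZS: "Z \<in> vector_fields S" using smooth_on_subset[OF Z(1)] vector_fields_open[OF open_S] by simp
  have N: "open (T \<inter> S)" "p \<in> T \<inter> S" using T p in_S open_S by auto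
  have sm: "smooth_on (T \<inter> S) V'" "smooth_on (T \<inter> S) W'" "smooth_on (T \<inter> S) Z"
    using VW' ZS unfolding vector_fields_open[OF open_S] by (auto intro: smooth_on_subset)
  have sub: "subspace (tangent_space S p)"
    using tangent_space_open[OF open_S in_S[OF p]] by (simp add: subspace_UNIV)
  have "2 * g p (nabM V W p) (Z p) = koszul g p V' W' Z"
    by (rule koszul_formula[OF M_subset p subspace_tangent[OF p] nabM VW Z(2) N sm]) (use T in auto)
  moreover have "2 * g p (nab V' W' p) (Z p) = koszul g p V' W' Z"
    by (rule koszul_formula[OF order_refl in_S[OF p] sub nab VW' ZS N sm]) auto
  ultimately show "g p (nabM V W p) w = g p (nab V' W' p) w" using Z(3) by simp
qed


lemma grad_restriction:
  assumes f: "smooth_on S f" and h: "\<And>x. x \<in> M \<Longrightarrow> f x = h x" and p: "p \<in> M"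
  shows "grad M g h p = tan_proj g M p (grad S g f p)"
proof (rule tan_proj_eqI[OF p, symmetric])
  interpret S: riemannian_submanifold S g S
    by unfold_locales (rule embedded_submanifold_refl[OF open_S])
  show "grad M g h p \<in> tangent_space M p"
    by (rule vector_fields_tangent[OF grad_vector_field[OF f h] p])
  fix w assume w: "w \<in> tangent_space M p"
  show "g p (grad M g h p) w = g p (grad S g f p) w"
    using g_grad[OF f h p w] S.g_grad[OF f refl in_S[OF p]] tangent_space_open[OF open_S in_S[OF p]]
    by simp
qed

theorem hessian_of_restriction:
  assumes nab: "levi_civita S g nab" and nabM: "levi_civita M g nabM"
    and f: "smooth_on S f" and h: "\<And>x. x \<in> M \<Longrightarrow> f x = h x"
    and V: "V \<in> vector_fields M" and V': "extends_to S M V U V'" and p: "p \<in> M"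
  shows "Hess M g nabM h V p
    = tan_proj g M p (Hess S g (local_connection S nab) f V' p)
      + weingarten S g nab M (\<lambda>q. nor_proj S g M q (grad S g f q)) V p"
proof -
  interpret S: riemannian_submanifold S g S
    by unfold_locales (rule embedded_submanifold_refl[OF open_S])
  define G where "G = grad S g f"
  define H where "H = grad M g h"
  have pS: "p \<in> S" by (rule in_S[OF p])
  have G: "G \<in> vector_fields S" unfolding G_def by (rule S.grad_vector_field[OF f refl])
  have H: "H \<in> vector_fields M" unfolding H_def by (rule grad_vector_field[OF f h])
  have GH: "tan_proj g M q (G q) = H q" if q: "q \<in> M" for q
    unfolding G_def H_def by (rule grad_restriction[OF f h q, symmetric])
  define N where "N q = nor_proj S g M q (G q)" for q
  have N: "N q = G q - H q" if "q \<in> M" for q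
    unfolding N_def using nor_proj_eq[OF that] GH[OF that] by simp
  have N_normal: "g q (N q) w = 0" if "q \<in> M" "w \<in> tangent_space M q" for q w
    using g_tan_proj[OF that, of "G q"] GH[OF that(1)] N[OF that(1)]
    by (simp add: g_simps in_S[OF that(1)])
  have U: "open U" "p \<in> U" "M \<subseteq> U" "U \<subseteq> S" "smooth_on U V'" "\<And>q. q \<in> M \<Longrightarrow> V' q = V q"
    using V' p vector_fields_open unfolding extends_to_def by auto
  obtain V1 T1 where V1: "V1 \<in> vector_fields S" "open T1" "p \<in> T1" "\<And>x. x \<in> T1 \<Longrightarrow> V1 x = V' x"
    using germ_vector_field[OF open_S U(1,2,5)] by metis
  \<comment> \<open>The gradient of \<open>h\<close> is given along \<open>M\<close> only;
    \<open>F\<close> extends it near \<open>p\<close>, and \<open>H1\<close> below is a field on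
    \<open>S\<close> with that germ.\<close>
  obtain T2 F where F: "open T2" "p \<in> T2" "smooth_on T2 F" "\<And>x. x \<in> T2 \<inter> M \<Longrightarrow> F x = H x"
    using vector_fields_local[OF H p] by metis
  obtain H1 T3 where H1: "H1 \<in> vector_fields S" "open T3" "p \<in> T3" "T3 \<subseteq> T2"
    "\<And>x. x \<in> T3 \<Longrightarrow> H1 x = F x"
    using germ_vector_field[OF open_S F(1-3)] by metis
  have H1M: "H1 q = H q" if "q \<in> T3 \<inter> M" for q using H1 F that by auto
  have hess: "Hess M g nabM h V p = tan_proj g M p (nab V1 H1 p)"
    unfolding Hess_def H_def[symmetric]
    by (rule gauss_formula[OF nab nabM p V H V1(1) H1(1), symmetric, of "T1 \<inter> T3"])
      (use V1 H1 H1M U(6) in auto)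
  have hessS: "Hess S g (local_connection S nab) f V' p = nab V1 G p"
    unfolding Hess_def G_def[symmetric]
    by (rule local_connection_eq[OF nab pS V1(1) G, of T1]) (use V1 in auto)
  \<comment> \<open>The value -\<pi>(\<nabla>V N), with \<pi> the tangential projection and the
    normal part represented near \<open>p\<close> by the difference of \<open>G\<close> and
    \<open>H1\<close>.\<close>
  define u where "u = tan_proj g M p (nab V1 H1 p) - tan_proj g M p (nab V1 G p)"
  have u: "u \<in> tangent_space M p"
    unfolding u_def by (intro subspace_diff subspace_tangent tan_proj_tangent p)
  \<comment> \<open>The characterization quantifies over all extensions, so \<open>V2\<close> may
    differ from the extension \<open>V'\<close> used to define \<open>u\<close>.\<close>
  have key: "g p u (W p) = g p (N p) (nor_proj S g M p (local_connection S nab V2 W2 p))"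
    if W: "W \<in> vector_fields M" and V2: "extends_to S M V U2 V2" and W2: "extends_to S M W U2 W2"
    for W U2 V2 W2
  proof -
    have U2: "open U2" "p \<in> U2" "M \<subseteq> U2" "smooth_on U2 V2" "smooth_on U2 W2"
      "\<And>q. q \<in> M \<Longrightarrow> V2 q = V q" "\<And>q. q \<in> M \<Longrightarrow> W2 q = W q"
      using V2 W2 p vector_fields_open unfolding extends_to_def by auto
    obtain V3 T4 where V3: "V3 \<in> vector_fields S" "open T4" "p \<in> T4" "\<And>x. x \<in> T4 \<Longrightarrow> V3 x = V2 x"
      using germ_vector_field[OF open_S U2(1,2,4)] by metis
    obtain W3 T5 where W3: "W3 \<in> vector_fields S" "open T5" "p \<in> T5" "\<And>x. x \<in> T5 \<Longrightarrow> W3 x = W2 x"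
      using germ_vector_field[OF open_S U2(1,2,5)] by metis
    have Wp: "W3 p = W p" "V3 p = V p" using W3 V3 U2 p by auto
    have Wt: "W p \<in> tangent_space M p" by (rule vector_fields_tangent[OF W p])
    have lc: "local_connection S nab V2 W2 p = nab V3 W3 p"
      by (rule local_connection_eq[OF nab pS V3(1) W3(1), of "T4 \<inter> T5"]) (use V3 W3 in auto)
    have "g p (N p) (nor_proj S g M p (nab V3 W3 p)) = g p (N p) (nab V3 W3 p)"
      unfolding nor_proj_eq[OF p] using N_normal[OF p tan_proj_tangent[OF p]]
      by (simp add: g_simps pS)
    also have "\<dots> = g p u (W p)"
    proof -
      define D where "D X = frechet_derivative (\<lambda>q. g q (X q) (W3 q)) (at p) (V p)" for X
      have sm: "smooth_on S (\<lambda>q. g q (X q) (W3 q))" if "X \<in> vector_fields S" for X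
        using that W3(1) unfolding vector_fields_open[OF open_S]
        by (intro smooth_on_g open_S order_refl)
      note d = smooth_on_has_derivative[OF sm pS]
      have mc: "D X = g p (nab V3 X p) (W p) + g p (X p) (nab V3 W3 p)" if X: "X \<in> vector_fields S" for X
      proof -
        have "tderiv S (\<lambda>q. g q (X q) (W3 q)) p (V3 p) = D X"
          unfolding D_def Wp(2)[symmetric]
          by (rule tderiv_eq[OF _ open_S pS d[OF X]]) (use tangent_space_open[OF open_S pS] in auto)
        then show ?thesis
          using nab X V3(1) W3(1) pS Wp unfolding levi_civita_def metric_compatible_def by metis
      qed
      \<comment> \<open>\<open>G - H1\<close> is normal along \<open>M\<close>, so its product with \<open>W\<close> has zero derivative along \<open>M\<close>.\<close>
      have "tderiv M (\<lambda>q. 0) p (V p) = D G - D H1"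
      proof -
        have d: "((\<lambda>q. g q (G q) (W3 q) - g q (H1 q) (W3 q)) has_derivative
            (\<lambda>v. frechet_derivative (\<lambda>q. g q (G q) (W3 q)) (at p) v
              - frechet_derivative (\<lambda>q. g q (H1 q) (W3 q)) (at p) v)) (at p)"
          by (intro has_derivative_diff d G H1)
        have 0: "g q (G q) (W3 q) - g q (H1 q) (W3 q) = 0" if q: "q \<in> (T3 \<inter> T5) \<inter> M" for q
        proof -
          have "W3 q = W q" using q W3(4) U2(7) by auto
          moreover have "H1 q = H q" using H1M q by auto
          ultimately show ?thesis
            using N_normal[of q "W q"] vector_fields_tangent[OF W] N[of q] q in_S[of q]
            by (simp add: g_simps)
        qed
        show ?thesis
          unfolding D_def
          by (rule tderiv_eq[where T = "T3 \<inter> T5", OF vector_fields_tangent[OF V p] _ _ d 0])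
            (use H1 W3 in auto)
      qed
      moreover have "tderiv M (\<lambda>q. 0) p (V p) = 0"
        by (rule tderiv_eq[OF vector_fields_tangent[OF V p] open_UNIV, of _ "\<lambda>_. 0"]) auto
      moreover have "H1 p = H p" using H1M H1(3) p by auto
      ultimately have "g p (N p) (nab V3 W3 p) = g p (nab V3 H1 p) (W p) - g p (nab V3 G p) (W p)"
        using mc[OF G] mc[OF H1(1)] N[OF p] by (simp add: g_simps pS)
      \<comment> \<open>Both fields extend \<open>V\<close>, so they agree at \<open>p\<close>
        although not near it; dependence on the value at \<open>p\<close> alone closes the
        gap.\<close>
      moreover have "nab V3 X p = nab V1 X p" if X: "X \<in> vector_fields S" for X
        using affine_connection_pointwise[OF open_S pS _ V3(1) V1(1) X] nab Wp(2) V1 U(6)[OF p]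
        unfolding levi_civita_def by simp
      ultimately show ?thesis
        unfolding u_def using G H1(1) g_tan_proj[OF p Wt] by (simp add: g_simps pS)
    qed
    finally show ?thesis unfolding lc by simp
  qed
  have "weingarten S g nab M N V p = u"
    unfolding weingarten_def
  proof (rule the_equality)
    show "u \<in> tangent_space M p \<and> (\<forall>W\<in>vector_fields M. \<forall>U V' W'.
        extends_to S M V U V' \<and> extends_to S M W U W' \<longrightarrow>
        g p u (W p) = g p (N p) (nor_proj S g M p (local_connection S nab V' W' p)))"
      using u key by blast
  next
    fix u' assume u': "u' \<in> tangent_space M p \<and> (\<forall>W\<in>vector_fields M. \<forall>U V' W'.
        extends_to S M V U V' \<and> extends_to S M W U W' \<longrightarrow>
        g p u' (W p) = g p (N p) (nor_proj S g M p (local_connection S nab V' W' p)))"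
    show "u' = u"
    proof (rule g_nondegenerate[OF pS subspace_tangent[OF p] _ u])
      fix w assume "w \<in> tangent_space M p"
      from vector_field_through_tangent_vector[OF embedded p this]
      obtain W where W: "smooth_on UNIV W" "W \<in> vector_fields M" "W p = w" by metis
      \<comment> \<open>A test pair on the same \<open>U\<close> as \<open>V'\<close> must exist for
        every tangent vector, otherwise the characterization would not determine
        \<open>u'\<close>.\<close>
      have "extends_to S M W U W"
        unfolding extends_to_def using U smooth_on_subset[OF W(1)] vector_fields_open[OF U(1)] by simp
      then show "g p u' w = g p u w"
        using u' key[OF W(2) V'] V' W by metis
    qed (use u' in auto)
  qed
  then show ?thesis
    unfolding hess hessS G_def[symmetric] N_def[symmetric] u_def by simp
qed

end

subsection \<open>Powers of a matrix with spectral radius less than one\<close>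

primrec mpow :: "'a::semiring_1^'n^'n \<Rightarrow> nat \<Rightarrow> 'a^'n^'n" where
  "mpow M 0 = mat 1"
| "mpow M (Suc k) = M ** mpow M k"

lemma mpow_Suc_right: "mpow M (Suc k) = mpow M k ** M"
  by (induction k) (simp, metis matrix_mul_assoc mpow.simps(2))

lemma funpow_matrix_mult: "((\<lambda>X. M ** X) ^^ k) C = mpow M k ** C"
  by (induction k) (simp_all add: matrix_mul_assoc)

definition cmat :: "real^'n^'m \<Rightarrow> complex^'n^'m" where
  "cmat M = (\<chi> i j. complex_of_real (M $ i $ j))"

lemma cmat_mat_1: "cmat (mat 1) = mat 1"
  by (simp add: cmat_def mat_def vec_eq_iff)

lemma cmat_mult: "cmat (M ** N) = cmat M ** cmat N"
  by (simp add: cmat_def matrix_matrix_mult_def vec_eq_iff)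

lemma cmat_mpow: "cmat (mpow M k) = mpow (cmat M) k"
  by (induction k) (simp_all add: cmat_mat_1 cmat_mult)

lemma mat_vector_mult: "mat z *v x = z *s x" for x :: "'a::semiring_1^'n"
  by (simp add: vec_eq_iff matrix_vector_mult_def mat_def if_distrib[of "\<lambda>a. a * _"] cong: if_cong)

text \<open>This is p(M) v.\<close>

definition papp :: "complex^'n^'n \<Rightarrow> complex poly \<Rightarrow> complex^'n \<Rightarrow> complex^'n" where
  "papp M p v = (\<Sum>i\<le>degree p. coeff p i *s (mpow M i *v v))"

lemma papp_eq:
  assumes "degree p \<le> N"
  shows "papp M p v = (\<Sum>i\<le>N. coeff p i *s (mpow M i *v v))"
  unfolding papp_def
  by (rule sum.mono_neutral_left) (use assms in \<open>auto simp: coeff_eq_0\<close>)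

lemma papp_linear_factor:
  "papp M ([:- z, 1:] * q) v = papp M q (M *v v - z *s v)"
proof -
  define N where "N = degree q"
  define w where "w i = mpow M i *v v" for i
  have p: "[:- z, 1:] * q = pCons 0 q - smult z q" by simp
  have "degree ([:- z, 1:] * q) \<le> Suc N"
    using degree_mult_le[of "[:- z, 1:]" q] unfolding N_def by simp
  then have "papp M ([:- z, 1:] * q) v = (\<Sum>i\<le>Suc N. (coeff (pCons 0 q) i - z * coeff q i) *s w i)"
    unfolding w_def by (subst papp_eq) (simp_all add: p del: sum.atMost_Suc)
  also have "\<dots> = (\<Sum>i\<le>Suc N. coeff (pCons 0 q) i *s w i) - (\<Sum>i\<le>Suc N. (z * coeff q i) *s w i)"
    by (simp only: vector_sub_rdistrib sum_subtractf)
  also have "(\<Sum>i\<le>Suc N. coeff (pCons 0 q) i *s w i) = (\<Sum>i\<le>N. coeff q i *s w (Suc i))"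
    by (subst sum.atMost_Suc_shift) simp
  also have "(\<Sum>i\<le>Suc N. (z * coeff q i) *s w i) = (\<Sum>i\<le>N. (z * coeff q i) *s w i)"
    by (simp add: N_def coeff_eq_0)
  also have "(\<Sum>i\<le>N. coeff q i *s w (Suc i)) - (\<Sum>i\<le>N. (z * coeff q i) *s w i)
      = (\<Sum>i\<le>N. coeff q i *s (mpow M i *v (M *v v - z *s v)))"
    unfolding sum_subtractf[symmetric]
    by (intro sum.cong refl)
      (simp add: w_def mpow_Suc_right matrix_vector_mul_assoc[symmetric] vector_smult_assoc
        matrix_vector_mult_diff_distrib vector_scalar_commute vector_ssub_ldistrib mult.commute
        del: mpow.simps)
  finally show ?thesis unfolding papp_def N_def .
qed

lemma papp_eigenvector:
  assumes "M *v v = z *s v"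
  shows "papp M p v = poly p z *s v"
proof -
  have "mpow M i *v v = z ^ i *s v" for i
    by (induction i)
      (simp_all add: assms matrix_vector_mul_assoc[symmetric] vector_scalar_commute
        vector_smult_assoc mult.commute)
  then show ?thesis
    unfolding papp_def by (simp add: poly_altdef vector_smult_assoc vec_eq_iff sum_distrib_right mult.assoc)
qed

lemma complex_poly_root_factor:
  fixes q :: "complex poly"
  assumes "degree q \<noteq> 0"
  obtains z r where "q = [:- z, 1:] * r" "degree r < degree q"
proof -
  obtain z where "poly q z = 0"
    using fundamental_theorem_of_algebra[of q] assms constant_degree[of q] by metis
  then obtain r where r: "q = [:- z, 1:] * r" unfolding poly_eq_0_iff_dvd by auto
  then have "r \<noteq> 0" using assms by auto
  then have "degree q = Suc (degree r)" unfolding r by (subst degree_mult_eq) auto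
  then show ?thesis using that r by auto
qed

lemma papp_degree_0:
  assumes "degree q = 0" "q \<noteq> 0" "papp M q v = 0"
  shows "v = 0"
proof -
  obtain a where "q = [:a:]" using assms(1) by (rule degree_eq_zeroE)
  then show ?thesis using assms by (simp add: papp_def)
qed

text \<open>Split off a root \<open>z\<close>: either \<open>M *v v - z *s v\<close> vanishes and
  \<open>v\<close> is an eigenvector, or it is a nonzero vector killed by the cofactor, which has
  smaller degree.\<close>

lemma eigenvector_of_annihilator:
  assumes "q \<noteq> 0" "papp M q v = 0" "v \<noteq> 0"
  shows "\<exists>z w. w \<noteq> 0 \<and> M *v w = z *s w"
  using assms
proof (induction "degree q" arbitrary: q v rule: less_induct)
  case less
  show ?case
  proof (cases "degree q = 0")
    case True
    then show ?thesis using papp_degree_0 less.prems by blast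
  next
    case False
    then obtain z r where r: "q = [:- z, 1:] * r" "degree r < degree q"
      by (rule complex_poly_root_factor)
    have "r \<noteq> 0" using r(1) less.prems(1) by auto
    moreover have "papp M r (M *v v - z *s v) = 0"
      using less.prems(2) papp_linear_factor[of M z r v] r(1) by simp
    ultimately show ?thesis
      using less.hyps[OF r(2)] less.prems(3) by (cases "M *v v - z *s v = 0") auto
  qed
qed

lemma contraction_recurrence_tendsto_0:
  fixes a b :: "nat \<Rightarrow> complex"
  assumes rec: "\<And>k. a (Suc k) = z * a k + b k" and z: "cmod z < 1" and b: "b \<longlonglongrightarrow> 0"
  shows "a \<longlonglongrightarrow> 0"
proof (rule LIMSEQ_I)
  fix e :: real assume e: "e > 0"
  \<comment> \<open>Chosen so that e/2 is the fixed point of t \<mapsto> |z| t + d.\<close>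
  define d where "d = e / 2 * (1 - cmod z)"
  have d: "d > 0" unfolding d_def using e z by simp
  obtain N where N: "\<And>k. k \<ge> N \<Longrightarrow> cmod (b k) < d" using LIMSEQ_D[OF b d] by auto
  have le: "cmod (a (N + m)) \<le> cmod z ^ m * cmod (a N) + e / 2" for m
  proof (induction m)
    case 0
    then show ?case using e by simp
  next
    case (Suc m)
    have "cmod (a (N + Suc m)) \<le> cmod z * cmod (a (N + m)) + cmod (b (N + m))"
      using norm_triangle_ineq[of "z * a (N + m)" "b (N + m)"] by (simp add: rec norm_mult)
    also have "\<dots> \<le> cmod z * (cmod z ^ m * cmod (a N) + e / 2) + d"
      using Suc N[of "N + m"] by (intro add_mono mult_left_mono) auto
    also have "\<dots> = cmod z ^ Suc m * cmod (a N) + e / 2" by (simp add: d_def field_simps)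
    finally show ?case .
  qed
  have lim: "(\<lambda>m. cmod z ^ m * cmod (a N)) \<longlonglongrightarrow> 0 * cmod (a N)"
    using z by (intro tendsto_mult LIMSEQ_power_zero tendsto_const) simp
  obtain m0 where m0: "\<And>m. m \<ge> m0 \<Longrightarrow> cmod z ^ m * cmod (a N) < e / 2"
    using LIMSEQ_D[OF lim, of "e / 2"] e by (auto simp: abs_mult)
  show "\<exists>no. \<forall>n\<ge>no. norm (a n - 0) < e"
  proof (intro exI[of _ "N + m0"] allI impI)
    fix n assume n: "n \<ge> N + m0"
    then have "cmod (a n) \<le> cmod z ^ (n - N) * cmod (a N) + e / 2" using le[of "n - N"] by simp
    moreover have "m0 \<le> n - N" using n by linarith
    ultimately show "norm (a n - 0) < e" unfolding diff_zero using m0[of "n - N"] by linarith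
  qed
qed

text \<open>Split off the roots \<open>z\<close> of an annihilating polynomial one at a time: roots in the open disc give
  a contracting recurrence, the others make \<open>M - z\<close> invertible.\<close>

lemma mpow_vector_tendsto_0:
  fixes M :: "complex^'n^'n"
  assumes ev: "\<And>z v. v \<noteq> 0 \<Longrightarrow> M *v v = z *s v \<Longrightarrow> cmod z < 1"
  shows "q \<noteq> 0 \<Longrightarrow> papp M q v = 0 \<Longrightarrow> (\<lambda>k. (mpow M k *v v) $ i) \<longlonglongrightarrow> 0"
proof (induction "degree q" arbitrary: q v i rule: less_induct)
  case less
  show ?case
  proof (cases "degree q = 0")
    case True
    then have "v = 0" using papp_degree_0 less.prems by blast
    then show ?thesis by simp
  next
    case False
    then obtain z r where r: "q = [:- z, 1:] * r" "degree r < degree q"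
      by (rule complex_poly_root_factor)
    define y where "y = M *v v - z *s v"
    have "r \<noteq> 0" using r(1) less.prems(1) by auto
    moreover have "papp M r y = 0"
      using less.prems(2) papp_linear_factor[of M z r v] r(1) unfolding y_def by simp
    ultimately have y: "(\<lambda>k. (mpow M k *v y) $ i) \<longlonglongrightarrow> 0" for i
      by (rule less.hyps[OF r(2)])
    have rec: "M *v (mpow M k *v v) = z *s (mpow M k *v v) + mpow M k *v y" for k
    proof -
      have "mpow M k *v (M *v v) = M *v (mpow M k *v v)"
        by (simp add: matrix_vector_mul_assoc mpow_Suc_right[symmetric] del: mpow.simps)
          (simp add: matrix_vector_mul_assoc)
      then show ?thesis
        unfolding y_def by (simp add: matrix_vector_mult_diff_distrib vector_scalar_commute)
    qed
    show ?thesis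
    proof (cases "cmod z < 1")
      case True
      show ?thesis
      proof (rule contraction_recurrence_tendsto_0[OF _ True y])
        show "(mpow M (Suc k) *v v) $ i = z * (mpow M k *v v) $ i + (mpow M k *v y) $ i" for k
          using rec[of k] by (simp add: matrix_vector_mul_assoc)
      qed
    next
      case False
      define N where "N = M - mat z"
      have N: "N *v x = M *v x - z *s x" for x
        unfolding N_def by (simp add: matrix_vector_mult_diff_rdistrib mat_vector_mult)
      have "\<forall>x. N *v x = 0 \<longrightarrow> x = 0" using ev False unfolding N by auto
      then obtain R where R: "R ** N = mat 1" using matrix_left_invertible_ker by metis
      have "mpow M k *v v = R *v (mpow M k *v y)" for k
      proof -
        have "N *v (mpow M k *v v) = mpow M k *v y" unfolding N rec by simp
        then have "R *v (mpow M k *v y) = (R ** N) *v (mpow M k *v v)"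
          by (simp add: matrix_vector_mul_assoc[symmetric])
        then show ?thesis unfolding R by simp
      qed
      moreover have "(\<lambda>k. \<Sum>j\<in>UNIV. R $ i $ j * (mpow M k *v y) $ j) \<longlonglongrightarrow> (\<Sum>j\<in>UNIV. R $ i $ j * 0)"
        by (intro tendsto_intros y)
      ultimately show ?thesis by (simp add: matrix_vector_mult_def[of R])
    qed
  qed
qed

text \<open>One more vector than the dimension. Dependence of a set does not see repetitions, so a
  repeated value is treated apart with coefficients 1 and -1.\<close>

lemma linear_relation_of_sequence:
  fixes f :: "nat \<Rightarrow> 'a::euclidean_space"
  obtains N c where "(\<Sum>i\<le>N. c i *\<^sub>R f i) = 0" "\<exists>i\<le>N. c i \<noteq> (0::real)"
proof (cases "inj_on f {..DIM('a)}")
  case True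
  then have "card (f ` {..DIM('a)}) > DIM('a)" by (simp add: card_image)
  then have "dependent (f ` {..DIM('a)})" using dependent_biggerset by blast
  then obtain u where u: "\<exists>v\<in>f ` {..DIM('a)}. u v \<noteq> 0" "(\<Sum>v\<in>f ` {..DIM('a)}. u v *\<^sub>R v) = 0"
    using real_vector.dependent_finite[of "f ` {..DIM('a)}"] by auto
  have "(\<Sum>i\<le>DIM('a). u (f i) *\<^sub>R f i) = 0"
    using u(2) by (simp add: sum.reindex[OF True])
  then show ?thesis by (rule that) (use u(1) in auto)
next
  case False
  then obtain i j where ij: "i \<le> DIM('a)" "j \<le> DIM('a)" "f i = f j" "i \<noteq> j"
    unfolding inj_on_def by auto
  define c where "c k = (if k = i then 1 else if k = j then - 1 else (0::real))" for k
  have "(\<Sum>k\<le>DIM('a). c k *\<^sub>R f k) = (\<Sum>k\<in>{i, j}. c k *\<^sub>R f k)"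
    by (rule sum.mono_neutral_right) (use ij in \<open>auto simp: c_def\<close>)
  also have "\<dots> = 0" using ij by (simp add: c_def)
  finally show ?thesis
    by (rule that) (use ij in \<open>auto simp: c_def intro!: exI[of _ i]\<close>)
qed

text \<open>The powers of \<open>M\<close> live in a finite-dimensional space of matrices, so they
  satisfy a linear relation; its coefficients are those of \<open>q\<close>.\<close>

lemma annihilating_polynomial:
  fixes M :: "real^'n^'n"
  obtains q where "q \<noteq> 0" "\<And>v. papp (cmat M) q v = 0"
proof -
  obtain N c where c: "(\<Sum>i\<le>N. c i *\<^sub>R mpow M i) = 0" "\<exists>i\<le>N. c i \<noteq> 0"
    using linear_relation_of_sequence[of "mpow M"] by metis
  define q where "q = (\<Sum>i\<le>N. monom (complex_of_real (c i)) i)"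
  have cq: "coeff q i = (if i \<le> N then complex_of_real (c i) else 0)" for i
    unfolding q_def by (simp add: coeff_sum)
  have "q \<noteq> 0" using c(2) cq by (metis coeff_0 of_real_eq_0_iff)
  moreover have "papp (cmat M) q v = 0" for v
  proof -
    have "degree q \<le> N" by (rule degree_le) (simp add: cq)
    then have "papp (cmat M) q v = (\<Sum>i\<le>N. complex_of_real (c i) *s (mpow (cmat M) i *v v))"
      by (simp add: papp_eq cq)
    also have "\<dots> = cmat (\<Sum>i\<le>N. c i *\<^sub>R mpow M i) *v v"
    proof -
      have "(\<Sum>k\<le>N. complex_of_real (c k) * (\<Sum>j\<in>UNIV. complex_of_real (mpow M k $ i $ j) * v $ j))
          = (\<Sum>j\<in>UNIV. (\<Sum>k\<le>N. complex_of_real (c k) * complex_of_real (mpow M k $ i $ j)) * v $ j)" for i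
        unfolding sum_distrib_left sum_distrib_right by (subst sum.swap) (simp add: mult.assoc)
      then show ?thesis
        unfolding cmat_mpow[symmetric] by (simp add: cmat_def vec_eq_iff matrix_vector_mult_def)
    qed
    finally show ?thesis unfolding c(1) by (simp add: cmat_def vec_eq_iff matrix_vector_mult_def)
  qed
  ultimately show ?thesis using that by blast
qed

text \<open>The \<open>Max\<close> is meaningful because the set of eigenvalues is finite,
  consisting of roots of an annihilating polynomial, and nonempty by
  \<open>eigenvector_of_annihilator\<close>.\<close>

lemma spectral_radius_less_1_iff:
  fixes M :: "real^'n^'n"
  shows "spectral_radius M < 1 \<longleftrightarrow> (\<forall>z v. v \<noteq> 0 \<longrightarrow> cmat M *v v = z *s v \<longrightarrow> cmod z < 1)"
proof -
  define E where "E = {z. \<exists>v. v \<noteq> 0 \<and> cmat M *v v = z *s v}"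
  have sr: "spectral_radius M = Max (cmod ` E)"
    unfolding spectral_radius_def E_def cmat_def by (rule arg_cong[of _ _ Max]) auto
  obtain q where q: "q \<noteq> 0" "\<And>v. papp (cmat M) q v = 0" using annihilating_polynomial[of M] by metis
  have "E \<subseteq> {z. poly q z = 0}"
    using papp_eigenvector[of "cmat M" _ _ q] q(2) unfolding E_def by (auto simp: vector_mul_eq_0)
  then have fin: "finite E" using poly_roots_finite[OF q(1)] finite_subset by blast
  \<comment> \<open>Any nonzero vector serves; \<open>undefined\<close> is just some index.\<close>
  have "(axis undefined 1 :: complex^'n) \<noteq> 0" by (simp add: axis_eq_0_iff)
  from eigenvector_of_annihilator[OF q(1) q(2) this] have "E \<noteq> {}" unfolding E_def by blast
  then have "spectral_radius M < 1 \<longleftrightarrow> (\<forall>z\<in>E. cmod z < 1)" unfolding sr using fin by simp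
  then show ?thesis unfolding E_def by blast
qed

lemma mpow_tendsto_0:
  fixes M :: "real^'n^'n"
  assumes "spectral_radius M < 1"
  shows "mpow M \<longlonglongrightarrow> 0"
proof (intro vec_tendstoI)
  fix i j
  obtain q where q: "q \<noteq> 0" "\<And>v. papp (cmat M) q v = 0" using annihilating_polynomial[of M] by metis
  have "(\<lambda>k. (mpow (cmat M) k *v axis j 1) $ i) \<longlonglongrightarrow> 0"
    using mpow_vector_tendsto_0[OF _ q(1) q(2)] assms unfolding spectral_radius_less_1_iff by blast
  moreover have "(mpow (cmat M) k *v axis j 1) $ i = complex_of_real (mpow M k $ i $ j)" for k
    unfolding cmat_mpow[symmetric]
    by (simp add: cmat_def matrix_vector_mult_def axis_def if_distrib cong: if_cong)
  ultimately have "(\<lambda>k. complex_of_real (mpow M k $ i $ j)) \<longlonglongrightarrow> complex_of_real 0" by simp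
  then show "(\<lambda>k. mpow M k $ i $ j) \<longlonglongrightarrow> 0 $ i $ j"
    unfolding tendsto_of_real_iff by simp
qed

text \<open>In the row where the eigenvector has its largest entry, the eigenvalue equation for the
  power bounds |z|^k by the absolute row sum.\<close>

lemma spectral_radius_less_1_of_power:
  fixes M :: "real^'n^'n"
  assumes "(\<Sum>i\<in>UNIV. \<Sum>j\<in>UNIV. \<bar>mpow M k $ i $ j\<bar>) < 1"
  shows "spectral_radius M < 1"
  unfolding spectral_radius_less_1_iff
proof (intro allI impI)
  fix z v assume v: "v \<noteq> 0" and eq: "cmat M *v v = z *s v"
  obtain i where i: "\<And>j. cmod (v $ j) \<le> cmod (v $ i)"
  proof -
    have "Max (range (\<lambda>j. cmod (v $ j))) \<in> range (\<lambda>j. cmod (v $ j))" by (intro Max_in) auto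
    then obtain i where "Max (range (\<lambda>j. cmod (v $ j))) = cmod (v $ i)" by (rule rangeE)
    then show ?thesis using that[of i] by (metis Max_ge finite finite_imageI rangeI)
  qed
  have pos: "cmod (v $ i) > 0"
  proof (rule ccontr)
    assume "\<not> ?thesis"
    then have "cmod (v $ j) \<le> 0" for j using i[of j] by simp
    then show False using v by (simp add: vec_eq_iff)
  qed
  have "mpow (cmat M) k *v v = z ^ k *s v"
    by (induction k)
      (simp_all add: eq matrix_vector_mul_assoc[symmetric] vector_scalar_commute
        vector_smult_assoc mult.commute)
  then have "z ^ k * v $ i = (\<Sum>j\<in>UNIV. complex_of_real (mpow M k $ i $ j) * v $ j)"
    unfolding cmat_mpow[symmetric] by (simp add: cmat_def matrix_vector_mult_def vec_eq_iff)
  then have "cmod z ^ k * cmod (v $ i) = cmod (\<Sum>j\<in>UNIV. complex_of_real (mpow M k $ i $ j) * v $ j)"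
    by (metis norm_mult norm_power)
  also have "\<dots> \<le> (\<Sum>j\<in>UNIV. cmod (complex_of_real (mpow M k $ i $ j) * v $ j))"
    by (rule norm_sum)
  also have "\<dots> \<le> (\<Sum>j\<in>UNIV. \<bar>mpow M k $ i $ j\<bar> * cmod (v $ i))"
    by (intro sum_mono) (simp add: norm_mult mult_left_mono i)
  also have "\<dots> = (\<Sum>j\<in>UNIV. \<bar>mpow M k $ i $ j\<bar>) * cmod (v $ i)" by (simp add: sum_distrib_right)
  finally have "cmod z ^ k \<le> (\<Sum>j\<in>UNIV. \<bar>mpow M k $ i $ j\<bar>)" using pos by simp
  also have "\<dots> \<le> (\<Sum>i\<in>UNIV. \<Sum>j\<in>UNIV. \<bar>mpow M k $ i $ j\<bar>)"
    by (rule member_le_sum[where f = "\<lambda>i. \<Sum>j\<in>UNIV. \<bar>mpow M k $ i $ j\<bar>"]) (auto intro: sum_nonneg)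
  finally have "cmod z ^ k < 1" using assms by simp
  then show "cmod z < 1" using one_le_power[of "cmod z" k] by linarith
qed

section \<open>Openness of the stabilizing set\<close>

lemma bounded_bilinear_matrix_mult:
  "bounded_bilinear (\<lambda>(A :: real^'n^'m) (B :: real^'p^'n). A ** B)"
  unfolding bilinear_conv_bounded_bilinear[symmetric] bilinear_def
  by (auto intro!: linearI simp: matrix_add_ldistrib matrix_matrix_mult_def vec_eq_iff
      sum.distrib algebra_simps sum_distrib_left)

lemma bounded_linear_transpose: "bounded_linear (transpose :: real^'n^'m \<Rightarrow> real^'m^'n)"
  unfolding linear_conv_bounded_linear[symmetric]
  by (rule linearI) (simp_all add: transpose_def vec_eq_iff)

text \<open>The set is a union over \<open>k\<close> of the conditions that the k-th power has
  absolute entry sum below one, and each of these is open since the entries depend continuously on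
  \<open>K\<close>.\<close>

lemma open_stabilizing:
  fixes A :: "real^'n^'n" and B :: "real^'m^'n"
  shows "open (stabilizing A B)"
proof -
  define s where "s k K = (\<Sum>i\<in>UNIV. \<Sum>j\<in>UNIV. \<bar>mpow (A + B ** K) k $ i $ j\<bar>)" for k K
  have "stabilizing A B = (\<Union>k. {K. s k K < 1})"
  proof (intro equalityI subsetI)
    fix K assume "K \<in> stabilizing A B"
    then have lim: "mpow (A + B ** K) \<longlonglongrightarrow> 0"
      unfolding stabilizing_def by (auto intro: mpow_tendsto_0)
    have "(\<lambda>k. s k K) \<longlonglongrightarrow> (\<Sum>i\<in>UNIV. \<Sum>j\<in>UNIV. \<bar>(0 :: real^'n^'n) $ i $ j\<bar>)"
      unfolding s_def by (intro tendsto_intros lim)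
    then have "\<forall>\<^sub>F k in sequentially. s k K < 1" by (intro order_tendstoD) auto
    then show "K \<in> (\<Union>k. {K. s k K < 1})" by (auto dest: eventually_happens)
  next
    fix K assume "K \<in> (\<Union>k. {K. s k K < 1})"
    then show "K \<in> stabilizing A B"
      unfolding s_def stabilizing_def by (auto intro: spectral_radius_less_1_of_power)
  qed
  moreover have "open {K. s k K < 1}" for k
  proof (rule open_Collect_less)
    have "continuous_on UNIV (\<lambda>K. mpow (A + B ** K) k)"
      by (induction k)
        (auto intro!: bounded_bilinear.continuous_on[OF bounded_bilinear_matrix_mult] continuous_intros)
    then show "continuous_on UNIV (s k)" unfolding s_def by (intro continuous_intros)
  qed simp
  ultimately show ?thesis by auto
qed

lemma transpose_zero: "transpose 0 = (0 :: real^'n^'m)"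
  by (simp add: transpose_def vec_eq_iff)

lemma transpose_plus: "transpose (X + Y) = transpose X + transpose Y" for X Y :: "real^'n^'m"
  by (rule linear_add[OF bounded_linear.linear[OF bounded_linear_transpose]])

subsection \<open>The Lyapunov equation\<close>

lemma linear_lyapunov_operator: "linear (\<lambda>X :: real^'n^'n. X - M ** X ** transpose M)"
  by (rule linearI)
    (simp_all add: matrix_add_ldistrib bounded_bilinear.add_left[OF bounded_bilinear_matrix_mult]
      bounded_bilinear.scaleR_left[OF bounded_bilinear_matrix_mult]
      bounded_bilinear.scaleR_right[OF bounded_bilinear_matrix_mult] algebra_simps)

text \<open>Iterating the homogeneous equation surrounds \<open>X\<close> with ever higher powers of
  \<open>M\<close>, which tend to zero.\<close>

lemma inj_lyapunov_operator:
  fixes M :: "real^'n^'n"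
  assumes "mpow M \<longlonglongrightarrow> 0"
  shows "inj (\<lambda>X :: real^'n^'n. X - M ** X ** transpose M)"
  unfolding linear_injective_0[OF linear_lyapunov_operator]
proof (intro allI impI)
  fix X assume "X - M ** X ** transpose M = 0"
  then have X: "X = M ** X ** transpose M" by simp
  have "X = mpow M k ** X ** transpose (mpow M k)" for k
  proof (induction k)
    case (Suc k)
    have "mpow M (Suc k) ** X ** transpose (mpow M (Suc k))
        = M ** (mpow M k ** X ** transpose (mpow M k)) ** transpose M"
      by (simp add: matrix_transpose_mul matrix_mul_assoc)
    then show ?case using Suc X by simp
  qed simp
  moreover have "(\<lambda>k. mpow M k ** X ** transpose (mpow M k)) \<longlonglongrightarrow> 0 ** X ** transpose 0"
    by (intro bounded_bilinear.tendsto[OF bounded_bilinear_matrix_mult]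
        bounded_linear.tendsto[OF bounded_linear_transpose] assms tendsto_const)
  ultimately have "(\<lambda>k. X) \<longlonglongrightarrow> 0 ** X ** transpose 0" by simp
  then have "X = 0 ** X ** transpose 0" by (simp add: LIMSEQ_const_iff)
  then show "X = 0" by (simp add: matrix_matrix_mult_def vec_eq_iff)
qed

lemma lyapunov_unique:
  fixes M :: "real^'n^'n"
  assumes "mpow M \<longlonglongrightarrow> 0" "X - M ** X ** transpose M = Z"
  shows "lyapunov M Z = X"
  unfolding lyapunov_def
proof (rule the_equality)
  show "X = M ** X ** transpose M + Z" using assms(2) by (simp add: algebra_simps)
next
  fix Y assume "Y = M ** Y ** transpose M + Z"
  then have "Y - M ** Y ** transpose M = X - M ** X ** transpose M"
    unfolding assms(2) by (simp add: algebra_simps)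
  then show "Y = X" using inj_lyapunov_operator[OF assms(1)] by (auto dest: injD)
qed

text \<open>Existence comes from injectivity, since the operator is a linear endomorphism of a
  finite-dimensional space.\<close>

lemma lyapunov_solves:
  fixes M :: "real^'n^'n"
  assumes "mpow M \<longlonglongrightarrow> 0"
  shows "lyapunov M Z = M ** lyapunov M Z ** transpose M + Z"
proof -
  obtain X where X: "X - M ** X ** transpose M = Z"
    using surjD[OF linear_injective_imp_surjective[OF linear_lyapunov_operator
          inj_lyapunov_operator[OF assms]], of Z] by auto
  show ?thesis unfolding lyapunov_unique[OF assms X] using X by (simp add: algebra_simps)
qed

lemma transpose_lyapunov:
  fixes M :: "real^'n^'n"
  assumes "mpow M \<longlonglongrightarrow> 0" "transpose Z = Z"
  shows "transpose (lyapunov M Z) = lyapunov M Z"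
proof (rule lyapunov_unique[OF assms(1), symmetric])
  define L where "L = lyapunov M Z"
  have "transpose L = transpose (M ** L ** transpose M + Z)"
    using lyapunov_solves[OF assms(1), of Z] unfolding L_def by simp
  also have "\<dots> = M ** transpose L ** transpose M + Z"
    using assms(2) by (simp add: transpose_plus matrix_transpose_mul matrix_mul_assoc)
  finally show "transpose (lyapunov M Z) - M ** transpose (lyapunov M Z) ** transpose M = Z"
    unfolding L_def by (simp add: algebra_simps)
qed

subsection \<open>Positive semidefinite matrices\<close>

lemma inner_transpose: "x \<bullet> (M *v y) = (transpose M *v x) \<bullet> y" for M :: "real^'n^'m"
  by (simp add: dot_lmul_matrix)

lemma psd_inner_commute: "psd R \<Longrightarrow> x \<bullet> (R *v y) = (R *v x) \<bullet> y"
  unfolding psd_def by (metis inner_transpose)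

text \<open>With w = R y the quadratic form at y + t w is 2 t |w|^2 + t^2 (w \<bullet> R w), which
  is negative for small negative t unless w = 0.\<close>

lemma psd_kernel:
  assumes R: "psd R" and y: "y \<bullet> (R *v y) = 0"
  shows "R *v y = 0"
proof (rule ccontr)
  assume ne: "R *v y \<noteq> 0"
  define w where "w = R *v y"
  define a where "a = w \<bullet> w"
  define b where "b = w \<bullet> (R *v w)"
  have a: "a > 0" unfolding a_def w_def using ne by simp
  have b: "b \<ge> 0" unfolding b_def using R unfolding psd_def by blast
  have "0 \<le> (y + t *\<^sub>R w) \<bullet> (R *v (y + t *\<^sub>R w))" for t using R unfolding psd_def by blast
  also have "(y + t *\<^sub>R w) \<bullet> (R *v (y + t *\<^sub>R w)) = 2 * t * a + t\<^sup>2 * b" for t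
    using y psd_inner_commute[OF R, of y w] unfolding a_def b_def
    by (simp add: w_def[symmetric] matrix_vector_right_distrib matrix_vector_mult_scaleR
        inner_add_left inner_add_right power2_eq_square algebra_simps)
  finally have q: "0 \<le> 2 * t * a + t\<^sup>2 * b" for t .
  \<comment> \<open>Adding 1 keeps the denominator positive when \<open>b = 0\<close>, and t b \<ge>
    -a leaves 2 a + t b \<ge> a > 0.\<close>
  define t where "t = - a / (b + 1)"
  have "2 * t * a + t\<^sup>2 * b = t * (2 * a + t * b)" by (simp add: power2_eq_square algebra_simps)
  moreover have "t < 0" unfolding t_def using a b by (simp add: divide_neg_pos)
  moreover have "t * b \<ge> - a" unfolding t_def using a b by (simp add: field_simps)
  ultimately show False using q[of t] a
    by (smt (verit) mult_neg_pos)
qed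

definition outer :: "real^'n \<Rightarrow> real^'n^'n" where
  "outer v = (\<chi> i j. v $ i * v $ j)"

lemma outer_vector: "outer v *v x = (v \<bullet> x) *\<^sub>R v"
  by (simp add: outer_def matrix_vector_mult_def vec_eq_iff inner_vec_def sum_distrib_left mult_ac)

text \<open>\<open>v\<close> maximizes the quadratic form on the unit sphere. Then l I - T is
  positive semidefinite with vanishing form at \<open>v\<close>, so \<open>psd_kernel\<close> turns
  the maximum into an eigenvector equation.\<close>

lemma psd_top_eigenvector:
  fixes T :: "real^'n^'n"
  assumes T: "psd T"
  obtains l v where "T *v v = l *\<^sub>R v" "norm v = 1" "\<And>x. x \<bullet> (T *v x) \<le> l * (x \<bullet> x)"
proof -
  have cont: "continuous_on (sphere 0 1) (\<lambda>x. x \<bullet> (T *v x))"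
    by (intro continuous_intros linear_continuous_on) (simp add: linear_conv_bounded_linear[symmetric])
  have ne: "sphere (0::real^'n) 1 \<noteq> {}" by simp
  obtain v where v: "norm v = 1" "\<And>x. norm x = 1 \<Longrightarrow> x \<bullet> (T *v x) \<le> v \<bullet> (T *v v)"
    using continuous_attains_sup[OF compact_sphere ne cont] by auto
  define l where "l = v \<bullet> (T *v v)"
  have le: "x \<bullet> (T *v x) \<le> l * (x \<bullet> x)" for x
  proof (cases "x = 0")
    case False
    have "(x /\<^sub>R norm x) \<bullet> (T *v (x /\<^sub>R norm x)) \<le> l"
      unfolding l_def by (rule v(2)) (use False in simp)
    then have "x \<bullet> (T *v x) \<le> l * (norm x)\<^sup>2"
      using False by (simp add: matrix_vector_mult_scaleR field_simps power2_eq_square)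
    then show ?thesis by (simp add: power2_norm_eq_inner)
  qed simp
  define N where "N = mat l - T"
  have N: "N *v x = l *\<^sub>R x - T *v x" for x
    unfolding N_def
    by (simp add: matrix_vector_mult_diff_rdistrib mat_vector_mult scalar_mult_eq_scaleR)
  have "transpose N = N"
    using T unfolding N_def psd_def by (simp add: transpose_def mat_def vec_eq_iff)
  then have "psd N"
    unfolding psd_def N using le by (simp add: inner_diff_right)
  moreover have "v \<bullet> (N *v v) = 0"
    unfolding N l_def using v(1) by (simp add: inner_diff_right norm_eq_1)
  ultimately have "T *v v = l *\<^sub>R v" using psd_kernel[of N v] N[of v] by simp
  then show ?thesis using that v(1) le by blast
qed

text \<open>Induction on the dimension of the kernel: subtracting \<open>\<lambda> v v\<^sup>T\<close> for a top eigenpair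
  \<open>(\<lambda>, v)\<close> enlarges the kernel by \<open>v\<close>.\<close>

lemma psd_sqrt_exists:
  fixes T :: "real^'n^'n"
  assumes "psd T"
  shows "\<exists>R. psd R \<and> R ** R = T"
  using assms
proof (induction "CARD('n) - dim {x. T *v x = 0}" arbitrary: T rule: less_induct)
  case less
  note T = less.prems
  show ?case
  proof (cases "T = 0")
    case True
    show ?thesis using True
      by (intro exI[of _ 0]) (simp add: psd_def transpose_zero matrix_matrix_mult_def vec_eq_iff)
  next
    case False
    obtain l v where v: "T *v v = l *\<^sub>R v" "norm v = 1" "\<And>x. x \<bullet> (T *v x) \<le> l * (x \<bullet> x)"
      using psd_top_eigenvector[OF T] by metis
    have vv: "v \<bullet> v = 1" using v(2) by (simp add: norm_eq_1)
    have l0: "l \<ge> 0"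
    proof -
      have "0 \<le> v \<bullet> (T *v v)" using T unfolding psd_def by blast
      then show ?thesis unfolding v(1) using vv by simp
    qed
    have l: "l > 0"
    proof (rule ccontr)
      assume "\<not> l > 0"
      then have "x \<bullet> (T *v x) \<le> 0" for x using v(3)[of x] l0 by simp
      moreover have "x \<bullet> (T *v x) \<ge> 0" for x using T unfolding psd_def by blast
      ultimately have "T *v x = 0" for x by (intro psd_kernel[OF T]) (simp add: antisym)
      then show False using False by (simp add: matrix_eq)
    qed
    define T' where "T' = T - l *\<^sub>R outer v"
    have T'v: "T' *v x = T *v x - (l * (v \<bullet> x)) *\<^sub>R v" for x
      unfolding T'_def by (simp add: matrix_vector_mult_diff_rdistrib scaleR_matrix_vector_assoc[symmetric] outer_vector)
    have vT: "v \<bullet> (T *v x) = l * (v \<bullet> x)" for x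
      using psd_inner_commute[OF T, of v x] v(1) by simp
    have T': "psd T'"
      unfolding psd_def
    proof
      show "transpose T' = T'"
        using T unfolding T'_def psd_def outer_def
        by (simp add: transpose_def vec_eq_iff mult.commute)
      show "\<forall>x. 0 \<le> x \<bullet> (T' *v x)"
      proof
        fix x
        define a where "a = v \<bullet> x"
        \<comment> \<open>The form of \<open>T'\<close> at \<open>x\<close> is the form of
          \<open>T\<close> at the component of \<open>x\<close> orthogonal to
          \<open>v\<close>.\<close>
        define y where "y = x - a *\<^sub>R v"
        have xT: "x \<bullet> (T *v v) = l * a" unfolding v(1) a_def by (simp add: inner_commute)
        have "0 \<le> y \<bullet> (T *v y)" using T unfolding psd_def by blast
        also have "y \<bullet> (T *v y) = x \<bullet> (T *v x) - l * a * a"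
          unfolding y_def using vT[of x] vT[of v] vv xT
          by (simp add: matrix_vector_mult_diff_distrib matrix_vector_mult_scaleR inner_diff_left
              inner_diff_right a_def[symmetric])
        also have "\<dots> = x \<bullet> (T' *v x)"
          unfolding T'v a_def by (simp add: inner_diff_right inner_commute)
        finally show "0 \<le> x \<bullet> (T' *v x)" .
      qed
    qed
    have "{x. T *v x = 0} \<subset> {x. T' *v x = 0}"
    proof
      have "v \<bullet> x = 0" if "T *v x = 0" for x using vT[of x] l that by simp
      then show "{x. T *v x = 0} \<subseteq> {x. T' *v x = 0}" by (auto simp: T'v)
      have "v \<in> {x. T' *v x = 0}" "v \<notin> {x. T *v x = 0}" using v vv l by (auto simp: T'v)
      then show "{x. T *v x = 0} \<noteq> {x. T' *v x = 0}" by blast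
    qed
    moreover have "span {x. X *v x = 0} = {x. X *v x = 0}" for X :: "real^'n^'n"
      by (simp add: span_eq_iff subspace_def matrix_vector_right_distrib matrix_vector_mult_scaleR)
    ultimately have "dim {x. T *v x = 0} < dim {x. T' *v x = 0}" by (intro dim_psubset) (simp only:)
    moreover have "dim {x. T' *v x = 0} \<le> CARD('n)" using dim_subset_UNIV[of "{x. T' *v x = 0}"] by simp
    ultimately obtain R where R: "psd R" "R ** R = T'" using less.hyps[OF _ T'] by fastforce
    have RR: "R *v (R *v x) = T' *v x" for x using R(2) by (simp add: matrix_vector_mul_assoc)
    \<comment> \<open>|R v|^2 is the form of \<open>T'\<close> at \<open>v\<close>, which is zero;
      hence the mixed terms in the square of \<open>Q\<close> vanish.\<close>
    have "(R *v v) \<bullet> (R *v v) = v \<bullet> (R *v (R *v v))" using psd_inner_commute[OF R(1)] by simp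
    also have "\<dots> = 0" unfolding RR T'v v(1) using vv by simp
    finally have Rv: "R *v v = 0" by simp
    define Q where "Q = R + sqrt l *\<^sub>R outer v"
    have Q: "Q *v x = R *v x + (sqrt l * (v \<bullet> x)) *\<^sub>R v" for x
      unfolding Q_def by (simp add: matrix_vector_mult_add_rdistrib scaleR_matrix_vector_assoc[symmetric] outer_vector)
    have "psd Q"
      unfolding psd_def
    proof
      show "transpose Q = Q"
        using R(1) unfolding Q_def psd_def outer_def
        by (simp add: transpose_def vec_eq_iff mult.commute)
      show "\<forall>x. 0 \<le> x \<bullet> (Q *v x)"
        using R(1) l0 unfolding psd_def Q
        by (simp add: inner_add_right inner_commute[of _ v] mult.assoc add_nonneg_nonneg)
    qed
    moreover have "Q ** Q = T"
    proof (subst matrix_eq, intro allI)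
      fix x
      have "v \<bullet> (R *v x) = 0" using psd_inner_commute[OF R(1), of v x] Rv by simp
      then have "Q *v (Q *v x) = T' *v x + (l * (v \<bullet> x)) *\<^sub>R v"
        unfolding Q using l0 vv Rv
        by (simp add: matrix_vector_right_distrib matrix_vector_mult_scaleR inner_add_right RR
            mult.assoc[symmetric])
      then show "(Q ** Q) *v x = T *v x" by (simp add: T'v matrix_vector_mul_assoc)
    qed
    ultimately show ?thesis by blast
  qed
qed

lemma trace_congruence:
  "trace (transpose X ** P ** X) = (\<Sum>i\<in>UNIV. column i X \<bullet> (P *v column i X))"
  for X :: "real^'k^'n"
proof -
  have "(transpose X ** P ** X) $ i $ i = column i X \<bullet> (P *v column i X)" for i
  proof -
    have "(transpose X ** (P ** X)) $ i $ i = (\<Sum>k\<in>UNIV. X $ k $ i * (P ** X) $ k $ i)"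
      by (simp add: matrix_matrix_mult_def transpose_def)
    also have "\<dots> = column i X \<bullet> (P *v column i X)"
      by (simp add: inner_vec_def column_def matrix_vector_mult_def matrix_matrix_mult_def)
    finally show ?thesis by (simp add: matrix_mul_assoc)
  qed
  then show ?thesis unfolding trace_def by simp
qed

lemma matrix_eq_0_columns: "(\<And>i. column i X = 0) \<Longrightarrow> X = 0"
  by (simp add: column_def vec_eq_iff)

lemma column_matrix_mult: "column i (M ** X) = M *v column i X"
  by (simp add: column_def matrix_vector_mult_def matrix_matrix_mult_def vec_eq_iff)

text \<open>With \<open>D = R - R'\<close> one has \<open>R' D = - D R\<close>, so the nonnegative traces of \<open>D R D\<close> and
  \<open>D R' D\<close> add up to zero.\<close>

lemma psd_sqrt_unique:
  fixes R R' :: "real^'n^'n"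
  assumes R: "psd R" and R': "psd R'" and eq: "R ** R = R' ** R'"
  shows "R = R'"
proof -
  note diffs = bounded_bilinear.diff_left[OF bounded_bilinear_matrix_mult]
    bounded_bilinear.diff_right[OF bounded_bilinear_matrix_mult]
    bounded_bilinear.add_left[OF bounded_bilinear_matrix_mult]
  define D where "D = R - R'"
  have D: "transpose D = D"
    using R R' unfolding D_def psd_def by (simp add: transpose_def vec_eq_iff)
  have "D ** R + R' ** D = 0" unfolding D_def using eq by (simp add: diffs)
  then have "trace ((D ** R + R' ** D) ** D) = 0" by (simp add: trace_def matrix_matrix_mult_def)
  then have "trace (D ** R ** D) + trace (R' ** D ** D) = 0" by (simp add: diffs trace_add)
  moreover have "trace (R' ** D ** D) = trace (D ** R' ** D)"
    using trace_mul_sym[of "R' ** D" D] by (simp add: matrix_mul_assoc)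
  ultimately have sum0: "(\<Sum>i\<in>UNIV. column i D \<bullet> (R *v column i D))
      + (\<Sum>i\<in>UNIV. column i D \<bullet> (R' *v column i D)) = 0"
    using trace_congruence[of D R] trace_congruence[of D R'] unfolding D by simp
  have nn: "column i D \<bullet> (R *v column i D) \<ge> 0" "column i D \<bullet> (R' *v column i D) \<ge> 0" for i
    using R R' unfolding psd_def by auto
  have "0 \<le> (\<Sum>i\<in>UNIV. column i D \<bullet> (R *v column i D))"
    "0 \<le> (\<Sum>i\<in>UNIV. column i D \<bullet> (R' *v column i D))"
    by (intro sum_nonneg nn)+
  then have s: "(\<Sum>i\<in>UNIV. column i D \<bullet> (R *v column i D)) = 0"
    "(\<Sum>i\<in>UNIV. column i D \<bullet> (R' *v column i D)) = 0"
    using sum0 by linarith+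
  have "R *v column i D = 0" "R' *v column i D = 0" for i
    using s nn by (auto simp: sum_nonneg_eq_0_iff intro!: psd_kernel R R')
  then have "D *v column i D = 0" for i
    unfolding D_def by (simp add: matrix_vector_mult_diff_rdistrib)
  \<comment> \<open>D annihilates its own columns and is symmetric, so |D e|^2 = e \<bullet> D D e =
    0 for each unit vector e.\<close>
  then have "column i D \<bullet> column i D = 0" for i
  proof -
    have "column i D = D *v axis i 1" by (simp add: matrix_vector_mult_basis)
    then have "column i D \<bullet> column i D = axis i 1 \<bullet> (D *v column i D)"
      using inner_transpose[of "axis i 1" D "column i D"] D by simp
    then show ?thesis using \<open>D *v column i D = 0\<close> by simp
  qed
  then have "D = 0" by (intro matrix_eq_0_columns) simp
  then show ?thesis unfolding D_def by simp
qed

lemma psd_sqrt: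
  assumes "psd Z"
  shows "psd (psd_sqrt Z)" "psd_sqrt Z ** psd_sqrt Z = Z"
proof -
  obtain R where R: "psd R" "R ** R = Z" using psd_sqrt_exists[OF assms] by blast
  have "psd_sqrt Z = R" unfolding psd_sqrt_def
    by (rule the_equality) (use R psd_sqrt_unique in auto)
  then show "psd (psd_sqrt Z)" "psd_sqrt Z ** psd_sqrt Z = Z" using R by auto
qed

lemma psd_Sigma_gain:
  assumes "psd Sig1" "psd Sig2"
  shows "psd (Sigma_gain Sig1 Sig2 K)"
proof -
  have "transpose (transpose K ** Sig2 ** K) = transpose K ** Sig2 ** K"
    using assms(2) unfolding psd_def by (simp add: matrix_transpose_mul matrix_mul_assoc)
  then have "transpose (Sigma_gain Sig1 Sig2 K) = Sigma_gain Sig1 Sig2 K"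
    using assms(1) unfolding psd_def Sigma_gain_def
    by (simp add: transpose_plus)
  moreover have "0 \<le> x \<bullet> (Sigma_gain Sig1 Sig2 K *v x)" for x
  proof -
    have "x \<bullet> ((transpose K ** Sig2 ** K) *v x) = (K *v x) \<bullet> (Sig2 *v (K *v x))"
      using inner_transpose[of x "transpose K" "Sig2 *v (K *v x)"]
      by (simp only: matrix_vector_mul_assoc[symmetric] transpose_transpose)
    then show ?thesis
      using assms unfolding psd_def Sigma_gain_def
      by (simp add: matrix_vector_mult_add_rdistrib inner_add_right)
  qed
  ultimately show ?thesis unfolding psd_def by blast
qed

text \<open>Unrolling the Lyapunov equation gives \<open>x\<^sup>T L x = \<Sum>\<^sub>j |C (M\<^sup>T)\<^sup>j x|\<^sup>2\<close>; if this vanishes then \<open>x\<close>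
  is orthogonal to the columns of all \<open>M\<^sup>j C\<close>.\<close>

lemma lyapunov_positive_definite:
  fixes M Z :: "real^'n^'n"
  assumes M: "mpow M \<longlonglongrightarrow> 0" and Z: "psd Z" and ctr: "controllable M (psd_sqrt Z)" and x: "x \<noteq> 0"
  shows "0 < x \<bullet> (lyapunov M Z *v x)"
proof -
  define L where "L = lyapunov M Z"
  define C where "C = psd_sqrt Z"
  have C: "transpose C = C" "C ** C = Z"
    using psd_sqrt[OF Z] unfolding C_def psd_def by auto
  define y where "y j = transpose (mpow M j) *v x" for j
  have y0: "y 0 = x" unfolding y_def by (simp del: transpose_matrix_vector)
  have ySuc: "y (Suc j) = transpose M *v y j" for j
    unfolding y_def mpow_Suc_right
    by (simp add: matrix_transpose_mul matrix_vector_mul_assoc del: transpose_matrix_vector)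
  have ZC: "v \<bullet> (Z *v v) = (C *v v) \<bullet> (C *v v)" for v
    using inner_transpose[of v C "C *v v"] C by (simp add: matrix_vector_mul_assoc)
  have step: "v \<bullet> (L *v v) = (C *v v) \<bullet> (C *v v) + (transpose M *v v) \<bullet> (L *v (transpose M *v v))" for v
  proof -
    have "v \<bullet> (L *v v) = v \<bullet> ((M ** L ** transpose M + Z) *v v)"
      using lyapunov_solves[OF M, of Z] unfolding L_def by simp
    also have "\<dots> = v \<bullet> (M *v (L *v (transpose M *v v))) + v \<bullet> (Z *v v)"
      by (simp only: matrix_vector_mult_add_rdistrib inner_add_right matrix_vector_mul_assoc matrix_mul_assoc)
    also have "\<dots> = (C *v v) \<bullet> (C *v v) + (transpose M *v v) \<bullet> (L *v (transpose M *v v))"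
      unfolding ZC inner_transpose[of v M] by simp
    finally show ?thesis .
  qed
  have unroll: "x \<bullet> (L *v x) = (\<Sum>j<k. (C *v y j) \<bullet> (C *v y j)) + y k \<bullet> (L *v y k)" for k
  proof (induction k)
    case 0
    then show ?case by (simp add: y0)
  next
    case (Suc k)
    then show ?case using step[of "y k"] unfolding ySuc by simp
  qed
  have lim: "(\<lambda>k. y k \<bullet> (L *v y k)) \<longlonglongrightarrow> 0"
  proof -
    have "(\<lambda>k. transpose (mpow M k)) \<longlonglongrightarrow> transpose 0"
      by (rule bounded_linear.tendsto[OF bounded_linear_transpose M])
    then have "(\<lambda>k. transpose (mpow M k) $ i $ j) \<longlonglongrightarrow> 0" for i j
      using tendsto_vec_nth[OF tendsto_vec_nth] unfolding transpose_zero by fastforce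
    then have "(\<lambda>k. \<Sum>j\<in>UNIV. transpose (mpow M k) $ i $ j * x $ j) \<longlonglongrightarrow> (\<Sum>j\<in>UNIV. 0 * x $ j)" for i
      by (intro tendsto_intros)
    then have "y \<longlonglongrightarrow> 0"
      unfolding y_def matrix_vector_mult_def by (intro vec_tendstoI) simp
    then have "(\<lambda>k. y k \<bullet> (L *v y k)) \<longlonglongrightarrow> 0 \<bullet> (L *v 0)"
      by (intro tendsto_intros bounded_linear.tendsto[of "(*v) L"])
        (simp_all add: linear_conv_bounded_linear[symmetric])
    then show ?thesis by simp
  qed
  \<comment> \<open>The sign of the remainder is not known here, so the partial sums are bounded by
    letting the remainder tend to zero.\<close>
  have le: "(\<Sum>j<k. (C *v y j) \<bullet> (C *v y j)) \<le> x \<bullet> (L *v x)" for k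
  proof -
    have "(\<lambda>m. x \<bullet> (L *v x) - y m \<bullet> (L *v y m)) \<longlonglongrightarrow> x \<bullet> (L *v x) - 0"
      by (intro tendsto_intros lim)
    moreover have "(\<Sum>j<k. (C *v y j) \<bullet> (C *v y j)) \<le> x \<bullet> (L *v x) - y m \<bullet> (L *v y m)" if "m \<ge> k" for m
    proof -
      have "(\<Sum>j<k. (C *v y j) \<bullet> (C *v y j)) \<le> (\<Sum>j<m. (C *v y j) \<bullet> (C *v y j))"
        by (rule sum_mono2) (use that in auto)
      then show ?thesis using unroll[of m] by simp
    qed
    ultimately show ?thesis by (intro LIMSEQ_le_const[of _ "x \<bullet> (L *v x)"]) auto
  qed
  show ?thesis
  proof (rule ccontr)
    assume "\<not> ?thesis"
    then have "x \<bullet> (L *v x) \<le> 0" unfolding L_def by simp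
    then have Cy: "C *v y j = 0" for j
    proof -
      have "(C *v y j) \<bullet> (C *v y j) \<le> (\<Sum>j<Suc j. (C *v y j) \<bullet> (C *v y j))"
        by (rule member_le_sum) auto
      then have "(C *v y j) \<bullet> (C *v y j) \<le> 0" using le[of "Suc j"] \<open>x \<bullet> (L *v x) \<le> 0\<close> by linarith
      then show ?thesis by (metis antisym inner_eq_zero_iff inner_ge_zero)
    qed
    have orth: "x \<bullet> c = 0" if c: "c \<in> columns (mpow M j ** C)" for c j
    proof -
      obtain i where "c = column i (mpow M j ** C)" using c unfolding columns_def by auto
      then have "c = mpow M j *v (C *v axis i 1)"
        by (simp add: column_matrix_mult matrix_vector_mult_basis)
      then have "x \<bullet> c = (C *v y j) \<bullet> axis i 1"
        using inner_transpose[of x "mpow M j"] inner_transpose[of "y j" C] C(1) unfolding y_def by metis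
      then show ?thesis unfolding Cy by simp
    qed
    define W where "W = (\<Union>k<CARD('n). columns (((\<lambda>X. M ** X) ^^ k) C))"
    have "dim W = DIM(real^'n)" using ctr unfolding controllable_def W_def C_def by simp
    then have "span W = UNIV" by (simp only: dim_eq_full)
    moreover have "span W \<subseteq> {c. x \<bullet> c = 0}"
      by (rule span_minimal)
        (auto simp: W_def funpow_matrix_mult orth subspace_def inner_add_right)
    ultimately have "x \<bullet> x = 0" by blast
    then show False using x by simp
  qed
qed

subsection \<open>The gain metric\<close>

lemma smooth_on_matrix_mult:
  fixes F :: "'a::euclidean_space \<Rightarrow> real^'n^'m" and G :: "'a \<Rightarrow> real^'p^'n"
  shows "open U \<Longrightarrow> smooth_on U F \<Longrightarrow> smooth_on U G \<Longrightarrow> smooth_on U (\<lambda>x. F x ** G x)"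
  by (rule smooth_on_bounded_bilinear[OF _ bounded_bilinear_matrix_mult])

lemma smooth_on_transpose:
  fixes F :: "'a::euclidean_space \<Rightarrow> real^'n^'m"
  shows "open U \<Longrightarrow> smooth_on U F \<Longrightarrow> smooth_on U (\<lambda>x. transpose (F x))"
  by (rule smooth_on_bounded_linear[OF _ bounded_linear_transpose])

text \<open>For each gain the equation is a linear system whose injective operator and right-hand
  side are polynomial in \<open>K\<close>; the smooth solution is the Lyapunov solution by
  uniqueness.\<close>

lemma smooth_on_lyapunov_gain:
  "smooth_on (stabilizing A B) (\<lambda>K. lyapunov (A + B ** K) (Sigma_gain Sig1 Sig2 K))"
proof -
  let ?S = "stabilizing A B"
  let ?F = "\<lambda>K X. X - (A + B ** K) ** X ** transpose (A + B ** K)"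
  note S = open_stabilizing[of A B]
  have pow: "mpow (A + B ** K) \<longlonglongrightarrow> 0" if "K \<in> ?S" for K
    using that unfolding stabilizing_def by (auto intro: mpow_tendsto_0)
  have cl: "smooth_on ?S (\<lambda>K. A + B ** K)"
    by (intro smooth_on_add smooth_on_matrix_mult smooth_on_const smooth_on_ident S)
  obtain R where R: "smooth_on ?S R" "\<And>K. K \<in> ?S \<Longrightarrow> ?F K (R K) = Sigma_gain Sig1 Sig2 K"
  proof (rule smooth_linear_solve[where F = ?F and z = "Sigma_gain Sig1 Sig2", OF S])
    show "linear (?F K)" for K by (rule linear_lyapunov_operator)
    show "inj (?F K)" if "K \<in> ?S" for K by (rule inj_lyapunov_operator[OF pow[OF that]])
    show "smooth_on ?S (\<lambda>K. ?F K Y)" for Y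
      by (intro smooth_on_diff smooth_on_matrix_mult smooth_on_transpose cl smooth_on_const S)
    show "smooth_on ?S (Sigma_gain Sig1 Sig2)"
      unfolding Sigma_gain_def[abs_def]
      by (intro smooth_on_add smooth_on_matrix_mult smooth_on_transpose smooth_on_ident smooth_on_const S)
  qed blast
  show ?thesis
    by (rule smooth_on_cong[OF S _ R(1)]) (use lyapunov_unique[OF pow R(2)] in simp)
qed

lemma riemannian_open_gain_metric:
  assumes "psd Sig1" "psd Sig2"
    and ctr: "\<forall>K\<in>stabilizing A B. controllable (A + B ** K) (psd_sqrt (Sigma_gain Sig1 Sig2 K))"
  shows "riemannian_open (stabilizing A B) (gain_metric A B Sig1 Sig2)"
proof
  define L where "L K = lyapunov (A + B ** K) (Sigma_gain Sig1 Sig2 K)" for K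
  have g: "gain_metric A B Sig1 Sig2 K V W = trace (transpose V ** W ** L K)" for K V W
    unfolding gain_metric_def L_def ..
  note tr = bounded_bilinear.add_left[OF bounded_bilinear_matrix_mult]
    bounded_bilinear.add_right[OF bounded_bilinear_matrix_mult]
    bounded_bilinear.scaleR_left[OF bounded_bilinear_matrix_mult]
    bounded_bilinear.scaleR_right[OF bounded_bilinear_matrix_mult]
    transpose_plus transpose_scalar
  have trace_scaleR: "trace (c *\<^sub>R X) = c *\<^sub>R trace X" for c and X :: "real^'k^'k"
    by (simp add: trace_def sum_distrib_left)
  show "open (stabilizing A B)" by (rule open_stabilizing)
  show "bilinear (gain_metric A B Sig1 Sig2 K)" for K
    unfolding bilinear_def g by (auto intro!: linearI simp: tr trace_add trace_scaleR)
  show "smooth_on (stabilizing A B) (\<lambda>K. gain_metric A B Sig1 Sig2 K V W)" for V W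
  proof -
    have "linear (\<lambda>X. trace (transpose V ** W ** X))"
      by (rule linearI) (simp_all add: tr trace_add trace_scaleR)
    then show ?thesis
      unfolding g L_def linear_conv_bounded_linear
      by (rule smooth_on_bounded_linear[OF open_stabilizing _ smooth_on_lyapunov_gain])
  qed
  fix K assume K: "K \<in> stabilizing A B"
  have pow: "mpow (A + B ** K) \<longlonglongrightarrow> 0"
    using K unfolding stabilizing_def by (auto intro: mpow_tendsto_0)
  note Z = psd_Sigma_gain[OF assms(1,2), of K]
  show "gain_metric A B Sig1 Sig2 K V W = gain_metric A B Sig1 Sig2 K W V" for V W
  proof -
    have "transpose (L K) = L K"
      unfolding L_def using Z by (intro transpose_lyapunov[OF pow]) (simp add: psd_def)
    then have "transpose (transpose V ** W ** L K) = L K ** (transpose W ** V)"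
      by (simp add: matrix_transpose_mul matrix_mul_assoc)
    moreover have "trace (transpose X) = trace X" for X :: "real^'a^'a"
      by (simp add: trace_def transpose_def)
    ultimately show ?thesis unfolding g using trace_mul_sym by metis
  qed
  show "0 < gain_metric A B Sig1 Sig2 K V V" if "V \<noteq> 0" for V
  proof -
    \<comment> \<open>By cyclicity of the trace the product becomes tr(V L V^T), a sum of values of
      the form of \<open>L\<close> at the rows of \<open>V\<close>.\<close>
    let ?X = "transpose V"
    have pos: "0 < x \<bullet> (L K *v x)" if "x \<noteq> 0" for x
      unfolding L_def using lyapunov_positive_definite[OF pow Z _ that] ctr K by blast
    have "gain_metric A B Sig1 Sig2 K V V = trace (transpose ?X ** L K ** ?X)"
      unfolding g using trace_mul_sym[of "transpose V" "V ** L K"] by (simp add: matrix_mul_assoc)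
    also have "\<dots> = (\<Sum>i\<in>UNIV. column i ?X \<bullet> (L K *v column i ?X))" by (rule trace_congruence)
    also have "\<dots> > 0"
    proof -
      have "?X \<noteq> 0" using that by (metis transpose_iff transpose_zero)
      then obtain i where i: "column i ?X \<noteq> 0" using matrix_eq_0_columns by blast
      have "0 \<le> x \<bullet> (L K *v x)" for x using pos[of x] by (cases "x = 0") auto
      then show ?thesis using pos[OF i] by (intro sum_pos2[where i = i]) auto
    qed
    finally show ?thesis .
  qed
qed

theorem mainTheorem2:
  fixes A :: "real^'n^'n" and B :: "real^'m^'n"
    and Sig1 :: "real^'n^'n" and Sig2 :: "real^'m^'m"
    and S M :: "(real^'n^'m) set"
    and g :: "(real^'n^'m) metric_tensor"
    and nab nabM :: "(real^'n^'m) conn"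
    and f h :: "real^'n^'m \<Rightarrow> real"
  assumes "stabilizable A B"
    and "S = stabilizing A B"
    and "psd Sig1" and "psd Sig2"
    and "\<forall>K\<in>S. controllable (A + B ** K) (psd_sqrt (Sigma_gain Sig1 Sig2 K))"
    and "g = gain_metric A B Sig1 Sig2"
    and "levi_civita S g nab"
    and "embedded_submanifold S M"
    and "levi_civita M g nabM"
    and "smooth_map S f"
    and "\<forall>K\<in>M. h K = f K"
  shows "smooth_map M h
    \<and> (\<forall>K\<in>M. grad M g h K = tan_proj g M K (grad S g f K))
    \<and> (\<forall>V\<in>vector_fields M. \<forall>U V'. extends_to S M V U V' \<longrightarrow>
         (\<forall>K\<in>M. Hess M g nabM h V K
            = tan_proj g M K (Hess S g (local_connection S nab) f V' K)
              + weingarten S g nab M (\<lambda>Q. nor_proj S g M Q (grad S g f Q)) V K))"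
proof -
  have "riemannian_open S g"
    unfolding assms(2,6) by (rule riemannian_open_gain_metric) (use assms(2-5) in auto)
  then interpret riemannian_submanifold S g M
    by (intro riemannian_submanifold.intro riemannian_submanifold_axioms.intro assms(8))
  have f: "smooth_on S f" by (rule smooth_map_smooth_on[OF assms(10) open_S])
  have h: "f K = h K" if "K \<in> M" for K using assms(11) that by simp
  have "smooth_map M h"
    unfolding smooth_map_def using open_S f h in_S by (intro ballI exI[of _ S] exI[of _ f]) auto
  moreover have "grad M g h K = tan_proj g M K (grad S g f K)" if "K \<in> M" for K
    by (rule grad_restriction[OF f h that])
  moreover have "Hess M g nabM h V K
      = tan_proj g M K (Hess S g (local_connection S nab) f V' K)
        + weingarten S g nab M (\<lambda>Q. nor_proj S g M Q (grad S g f Q)) V K"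
    if "V \<in> vector_fields M" "extends_to S M V U V'" "K \<in> M" for V U V' K
    by (rule hessian_of_restriction[OF assms(7,9) f h that])
  ultimately show ?thesis by blast
qed

end
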